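(* Let $n,k$ be integers with $2\leq k\leq n-4$, and let $G$ be a connected graph of order $n$ (so $n\geq k+4$) with minimum degree $\delta\geq k+1$. If $$M_{1}(G)\geq n^{3}-8n^{2}+(4k+25)n+2k^{2}-4k-24,$$ then $G$ is $k$-leaf-connected unless $G$ is (isomorphic to) a member of $\{K_{3}\vee(K_{n-5}+2K_{1}),\ K_{4}\vee4K_{1},\ K_{3}\vee (K_{1,3}+K_{1}),\ K_{4}\vee(K_{2}+3K_{1}),\ K_{5}\vee5K_{1}\}$.
   Context: All graphs are finite, simple and undirected; the order of $G$ is $|V(G)|$. $d_G(v)$ is the degree of the vertex $v$ in $G$, and $\delta=\delta(G)$ is the minimum degree. The first Zagreb index is $M_{1}(G)=\sum_{v\in V(G)}d_{G}(v)^{2}$. For $k\geq 2$, a graph $G$ with $|V(G)|\geq k+1$ is $k$-leaf-connected if for every subset $S\subseteq V(G)$ with $|S|=k$, $G$ has a spanning tree $T$ such that $S$ is precisely the set of leaves of $T$. For vertex-disjoint graphs $G$ and $H$, $G+H$ is their disjoint union, $tG$ is the disjoint union of $t$ copies of $G$, and the join $G\vee H$ is obtained from $G+H$ by adding all possible edges between $V(G)$ and $V(H)$. $K_n$ is the complete graph of order $n$ and $K_{1,3}$ is the star with three leaves. *)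

theory Defs
  imports
    Graph_Theory.Digraph_Component
    Graph_Theory.Digraph_Isomorphism
    Graph_Theory.Kuratowski
begin

text \<open>
  A finite simple undirected graph is a \<^locale>\<open>pair_graph\<close> of the AFP entry Graph\_Theory, i.e. a
  finite, loop-free, symmetric digraph whose arcs are ordered pairs of vertices: an edge $uv$
  is represented by the two arcs $(u,v)$ and $(v,u)$, so the degree of a vertex is its out-degree.
\<close>

abbreviation vertex_degree :: "'a pair_pre_digraph \<Rightarrow> 'a \<Rightarrow> nat" where
  "vertex_degree G v \<equiv> out_degree (with_proj G) v"

definition min_degree :: "'a pair_pre_digraph \<Rightarrow> nat" where
  "min_degree G = Min (vertex_degree G ` pverts G)"

definition first_zagreb :: "'a pair_pre_digraph \<Rightarrow> nat" where
  "first_zagreb G = (\<Sum>v\<in>pverts G. (vertex_degree G v)\<^sup>2)"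

text \<open>
  The constants \<^const>\<open>tree\<close> and \<^const>\<open>spanning_tree\<close> of Graph\_Theory forbid
  \<^emph>\<open>directed\<close> cycles only and count the walk $u, v, u$ along a single edge as a cycle, so
  they do not describe undirected trees. Hence the restriction to cycles of length at least 3 here.
\<close>

definition undirected_tree :: "'a pair_pre_digraph \<Rightarrow> bool" where
  "undirected_tree T \<longleftrightarrow>
     pair_graph T \<and> Digraph_Component.connected (with_proj T) \<and>
     \<not> (\<exists>p. pre_digraph.cycle (with_proj T) p \<and> 3 \<le> length p)"

definition tree_leaves :: "'a pair_pre_digraph \<Rightarrow> 'a set" where
  "tree_leaves T = {v \<in> pverts T. vertex_degree T v = 1}"

definition k_leaf_connected :: "nat \<Rightarrow> 'a pair_pre_digraph \<Rightarrow> bool" where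
  "k_leaf_connected k G \<longleftrightarrow>
     k + 1 \<le> card (pverts G) \<and>
     (\<forall>S. S \<subseteq> pverts G \<and> card S = k \<longrightarrow>
        (\<exists>T. undirected_tree T \<and> spanning (with_proj T) (with_proj G) \<and> tree_leaves T = S))"

abbreviation graph_iso :: "'a pair_pre_digraph \<Rightarrow> 'b pair_pre_digraph \<Rightarrow> bool" where
  "graph_iso G H \<equiv> digraph_iso (with_proj G) (with_proj H)"

definition complete_graph :: "nat \<Rightarrow> nat pair_pre_digraph" where
  "complete_graph n = \<lparr>pverts = {..<n}, parcs = {(u, v). u < n \<and> v < n \<and> u \<noteq> v}\<rparr>"

definition graph_union ::
    "'a pair_pre_digraph \<Rightarrow> 'b pair_pre_digraph \<Rightarrow> ('a + 'b) pair_pre_digraph" where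
  "graph_union G H =
     \<lparr>pverts = pverts G <+> pverts H,
      parcs = map_prod Inl Inl ` parcs G \<union> map_prod Inr Inr ` parcs H\<rparr>"

definition graph_copies :: "nat \<Rightarrow> 'a pair_pre_digraph \<Rightarrow> (nat \<times> 'a) pair_pre_digraph" where
  "graph_copies t G =
     \<lparr>pverts = {..<t} \<times> pverts G,
      parcs = {((i, u), (j, v)) | i j u v. i < t \<and> j = i \<and> (u, v) \<in> parcs G}\<rparr>"

definition graph_join ::
    "'a pair_pre_digraph \<Rightarrow> 'b pair_pre_digraph \<Rightarrow> ('a + 'b) pair_pre_digraph" where
  "graph_join G H =
     \<lparr>pverts = pverts (graph_union G H),
      parcs = parcs (graph_union G H) \<union>
        (Inl ` pverts G \<times> Inr ` pverts H) \<union> (Inr ` pverts H \<times> Inl ` pverts G)\<rparr>"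

definition star_graph :: "nat \<Rightarrow> nat pair_pre_digraph" where
  "star_graph t = \<lparr>pverts = {0..t}, parcs = ({0} \<times> {1..t}) \<union> ({1..t} \<times> {0})\<rparr>"

lemma complete_digraph_complete_graph: "complete_digraph n (with_proj (complete_graph n))"
  by (auto simp: complete_digraph_pair_def complete_graph_def)

lemma complete_bipartite_digraph_star_graph:
  "complete_bipartite_digraph 1 t (with_proj (star_graph t))"
proof -
  have "{0..t} = {0} \<union> {1..t} \<and> {0} \<inter> {1..t} = {} \<and> card {0::nat} = 1 \<and> card {1..t} = t"
    by auto
  then show ?thesis
    unfolding complete_bipartite_digraph_pair_def star_graph_def pair_pre_digraph.simps by blast
qed

lemma pair_graph_iff:
  "pair_graph G \<longleftrightarrow>
     finite (pverts G) \<and> parcs G \<subseteq> pverts G \<times> pverts G \<and> sym (parcs G) \<and> irrefl (parcs G)"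
proof
  assume "pair_graph G"
  then interpret pair_graph G .
  show "finite (pverts G) \<and> parcs G \<subseteq> pverts G \<times> pverts G \<and> sym (parcs G) \<and> irrefl (parcs G)"
    using pair_finite_verts arc_fst_in_verts arc_snd_in_verts pair_sym_arcs pair_no_loops
    by (fastforce simp: symmetric_def irrefl_def)
next
  assume *: "finite (pverts G) \<and> parcs G \<subseteq> pverts G \<times> pverts G \<and> sym (parcs G) \<and> irrefl (parcs G)"
  then have "finite (parcs G)"
    by (meson finite_SigmaI finite_subset)
  with * show "pair_graph G"
    by unfold_locales (auto simp: symmetric_def irrefl_def)
qed

lemma pair_graph_graph_union:
  "pair_graph G \<Longrightarrow> pair_graph H \<Longrightarrow> pair_graph (graph_union G H)"
  unfolding pair_graph_iff graph_union_def sym_def irrefl_def by auto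

lemma pair_graph_graph_copies: "pair_graph G \<Longrightarrow> pair_graph (graph_copies t G)"
  unfolding pair_graph_iff graph_copies_def sym_def irrefl_def by auto

lemma pair_graph_graph_join:
  "pair_graph G \<Longrightarrow> pair_graph H \<Longrightarrow> pair_graph (graph_join G H)"
  unfolding pair_graph_iff graph_join_def graph_union_def sym_def irrefl_def by auto

lemma graph_iso_iff:
  assumes "pair_graph G"
  shows "graph_iso G H \<longleftrightarrow>
    (\<exists>f. inj_on f (pverts G) \<and> pverts H = f ` pverts G \<and> parcs H = map_prod f f ` parcs G)"
proof
  assume "graph_iso G H"
  then obtain h where h: "pre_digraph.digraph_isomorphism (with_proj G) h"
    "with_proj H = app_iso h (with_proj G)"
    by (auto simp: digraph_iso_def)
  have eqs: "pverts H = iso_verts h ` pverts G" "parcs H = iso_arcs h ` parcs G"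
    "iso_tail h = fst" "iso_head h = snd"
    using h(2) by (auto simp: with_proj_def app_iso_def)
  have "iso_arcs h a = map_prod (iso_verts h) (iso_verts h) a" if "a \<in> parcs G" for a
    using h(1) that eqs(3,4)
    by (auto simp: pre_digraph.digraph_isomorphism_def with_proj_def prod_eq_iff)
  then have "parcs H = map_prod (iso_verts h) (iso_verts h) ` parcs G"
    unfolding eqs(2) by (rule image_cong[OF refl])
  moreover have "inj_on (iso_verts h) (pverts G)"
    using h(1) by (auto simp: pre_digraph.digraph_isomorphism_def with_proj_def)
  ultimately show "\<exists>f. inj_on f (pverts G) \<and> pverts H = f ` pverts G \<and> parcs H = map_prod f f ` parcs G"
    using eqs(1) by blast
next
  assume "\<exists>f. inj_on f (pverts G) \<and> pverts H = f ` pverts G \<and> parcs H = map_prod f f ` parcs G"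
  then obtain f where f: "inj_on f (pverts G)" "pverts H = f ` pverts G"
    "parcs H = map_prod f f ` parcs G" by blast
  interpret pair_graph G by fact
  have "parcs G \<subseteq> pverts G \<times> pverts G"
    using assms by (simp add: pair_graph_iff)
  then have "inj_on (map_prod f f) (parcs G)"
    using inj_on_subset[OF map_prod_inj_on[OF f(1) f(1)]] by blast
  then have "pre_digraph.digraph_isomorphism (with_proj G)
      \<lparr>iso_verts = f, iso_arcs = map_prod f f, iso_head = snd, iso_tail = fst\<rparr>"
    using f(1) wf_digraph_axioms by (auto simp: pre_digraph.digraph_isomorphism_def)
  moreover have "with_proj H = app_iso
      \<lparr>iso_verts = f, iso_arcs = map_prod f f, iso_head = snd, iso_tail = fst\<rparr> (with_proj G)"
    using f(2,3) by (simp add: app_iso_def with_proj_def)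
  ultimately show "graph_iso G H"
    unfolding digraph_iso_def by blast
qed

end

theory Submission
  imports Defs
begin

text \<open>
Write $D$ for the degree function of a graph with $n$ vertices. The proof has three ingredients.

\<^item> A closure property of Bondy--Chvatal type (\<open>has_tree_remove_edge\<close>): if $u$ and $v$ are not
  adjacent and $D(u) + D(v) \geq n + k - 1$, then every spanning tree of $G + uv$ with $k$ leaves can
  be turned into one of $G$ with the same leaves. Removing $uv$ from the tree leaves two
  components; an edge $wp$ of one of them is exchanged together with $uv$ for the two edges that
  cross over between the same four vertices, which changes no degree of the tree. If no such
  exchange is possible, then every neighbour of $u$ or $v$ that could take part forbids another one,
  and counting gives $D(u) + D(v) \leq n + k - 2$.

\<^item> A degree sequence argument (\<open>split_structure\<close>). Extend a graph that is not
  $k$-leaf-connected to an edge-maximal one, $F$. Nonadjacent vertices of $F$ have degree sum at most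
  $n + k - 2$. For a nonadjacent pair with the largest sum $a + b$, where $a \leq b$, the $n - 1 - b$
  other vertices that are not adjacent to the second one have degree at most $a$, and the $n - a$ that are not
  adjacent to the first one, itself included, have degree at most $b$. Hence $M_1(F)$ is at most the value for
  $K_a \vee (K_q + p K_1)$ with $q = b + 1 - a$ and $p = n - 1 - b$. The given bound is the value
  for $a = k + 1$, $p = 2$. By an explicit polynomial identity (\<open>zagreb_gap\<close>) only four
  shapes reach it: $K_{k+1} \vee (K_{n-k-3} + 2K_1)$, $K_{k+2} \vee 4K_1$,
  $K_{k+2} \vee (K_2 + 3K_1)$ and $K_{k+3} \vee 5K_1$. They reach it so narrowly that $F$ is
  one of them.

\<^item> For $k \geq 3$ these four graphs are $k$-leaf-connected after all: the number of cliques
  left when the dominating vertices are deleted is smaller than the number of dominating vertices,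
  and then the required trees can be built directly (\<open>split_graph_has_tree\<close>).

Hence a graph $G$ that is not $k$-leaf-connected has $k = 2$ and is a spanning subgraph of one of the four graphs $F$. The difference between
$M_1(F)$ and the bound is $0$, $20$, $0$ and $24$, respectively. Removing an edge $xy$ costs
$2(D(x) + D(y)) - 2$, so $G = F$ except that $K_4 \vee 4K_1$ can lose one edge between its
two parts; the result is $K_3 \vee (K_{1,3} + K_1)$.
\<close>

section \<open>Rooted trees and the exchange of edges\<close>

text \<open>
A tree is given by a parent function $p$ that sends each vertex other than the root $r$ along an
edge, and a rank $h$ that decreases towards the root and thereby excludes cycles. Exchanging edges then
amounts to changing $p$ at one or two places and adjusting $h$.
\<close>
definition rooted_tree ::
    "('a \<times> 'a) set \<Rightarrow> 'a set \<Rightarrow> 'a \<Rightarrow> ('a \<Rightarrow> 'a) \<Rightarrow> ('a \<Rightarrow> nat) \<Rightarrow> bool" where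
  "rooted_tree E W r p h \<longleftrightarrow>
     finite W \<and> r \<in> W \<and> (\<forall>x\<in>W - {r}. p x \<in> W \<and> (x, p x) \<in> E \<and> h (p x) < h x)"

definition children :: "'a set \<Rightarrow> 'a \<Rightarrow> ('a \<Rightarrow> 'a) \<Rightarrow> 'a \<Rightarrow> 'a set" where
  "children W r p x = {w \<in> W - {r}. p w = x}"

definition tree_arcs :: "'a set \<Rightarrow> 'a \<Rightarrow> ('a \<Rightarrow> 'a) \<Rightarrow> ('a \<times> 'a) set" where
  "tree_arcs W r p = {(x, y). (x \<in> W - {r} \<and> y = p x) \<or> (y \<in> W - {r} \<and> x = p y)}"

definition tree_degree :: "'a set \<Rightarrow> 'a \<Rightarrow> ('a \<Rightarrow> 'a) \<Rightarrow> 'a \<Rightarrow> nat" where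
  "tree_degree W r p x = card (tree_arcs W r p `` {x})"

text \<open>
Here $L$ is the exact set of leaves. Neither the root nor the rank is part of the
statement, because \<open>reroot\<close> below can move the root to any vertex.
\<close>
definition has_tree :: "('a \<times> 'a) set \<Rightarrow> 'a set \<Rightarrow> 'a set \<Rightarrow> bool" where
  "has_tree E W L \<longleftrightarrow>
     (\<exists>r p h. rooted_tree E W r p h \<and> L = {x \<in> W. tree_degree W r p x = 1})"

lemma has_treeI:
  assumes "rooted_tree E W r p h" "{x \<in> W. tree_degree W r p x = 1} = L"
  shows "has_tree E W L"
  using assms unfolding has_tree_def by blast

lemma rooted_treeD:
  assumes "rooted_tree E W r p h"
  shows "finite W" "r \<in> W" "x \<in> W \<Longrightarrow> x \<noteq> r \<Longrightarrow> p x \<in> W"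
    "x \<in> W \<Longrightarrow> x \<noteq> r \<Longrightarrow> (x, p x) \<in> E" "x \<in> W \<Longrightarrow> x \<noteq> r \<Longrightarrow> h (p x) < h x"
  using assms by (auto simp: rooted_tree_def)

text \<open>
Following parents leads from any vertex to the root, and the rank drops at each step.
\<close>
lemma root_rank_less:
  assumes "rooted_tree E W r p h" "x \<in> W" "x \<noteq> r"
  shows "h r < h x"
  using assms(2,3)
proof (induction "h x" arbitrary: x rule: less_induct)
  case less
  note T = rooted_treeD[OF assms(1)]
  from T(5)[OF less.prems] have "h (p x) < h x" .
  then show ?case
    using less.hyps[of "p x"] T(3)[OF less.prems] by (cases "p x = r") auto
qed

text \<open>
The parent of $x$ is not also one of its children, since the rank would have to drop both ways.
\<close>
lemma tree_degree_eq:
  assumes "rooted_tree E W r p h" "x \<in> W"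
  shows "tree_degree W r p x = card (children W r p x) + (if x = r then 0 else 1)"
proof -
  note T = rooted_treeD[OF assms(1)]
  have eq: "tree_arcs W r p `` {x} = children W r p x \<union> (if x = r then {} else {p x})"
    using assms(2) by (auto simp: tree_arcs_def children_def)
  have fin: "finite (children W r p x)"
    using T(1) by (auto simp: children_def)
  have "p x \<notin> children W r p x" if "x \<noteq> r"
  proof
    assume "p x \<in> children W r p x"
    then have "p x \<in> W" "p x \<noteq> r" "p (p x) = x" by (auto simp: children_def)
    then show False
      using T(5)[of "p x"] T(5)[OF assms(2) that] by simp
  qed
  then show ?thesis
    using fin by (simp add: tree_degree_def eq)
qed

lemma has_tree_leaves_subset: "has_tree E W L \<Longrightarrow> L \<subseteq> W"
  by (auto simp: has_tree_def)

lemma has_tree_mono: "has_tree E W L \<Longrightarrow> E \<subseteq> F \<Longrightarrow> has_tree F W L"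
  unfolding has_tree_def rooted_tree_def by blast

text \<open>
The set $B$ consists of $v$ and its descendants. It is described by a closure property that stays
the same when $B$ is complemented and $u$ and $v$ are exchanged, so that one lemma can treat both
sides of an edge.
\<close>
lemma branch_exists:
  assumes "rooted_tree E W u p h" "v \<in> W" "v \<noteq> u"
  obtains B where "v \<in> B" "u \<notin> B" "\<And>x. x \<in> W - {u, v} \<Longrightarrow> x \<in> B \<longleftrightarrow> p x \<in> B"
proof -
  define R where "R = {(x, p x) | x. x \<in> W - {u}}"
  define B where "B = {x. (x, v) \<in> R\<^sup>*}"
  have "u \<notin> B"
  proof
    assume "u \<in> B"
    then have "(u, v) \<in> R\<^sup>*" by (simp add: B_def)
    then show False
      using assms(3) by (cases rule: converse_rtranclE) (auto simp: R_def)
  qed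
  moreover have "x \<in> B \<longleftrightarrow> p x \<in> B" if "x \<in> W - {u, v}" for x
  proof
    assume "x \<in> B"
    then have "(x, v) \<in> R\<^sup>*" by (simp add: B_def)
    then show "p x \<in> B"
      using that by (cases rule: converse_rtranclE) (auto simp: R_def B_def)
  next
    assume "p x \<in> B"
    moreover have "(x, p x) \<in> R" using that by (auto simp: R_def)
    ultimately show "x \<in> B"
      unfolding B_def by (auto intro: converse_rtrancl_into_rtrancl)
  qed
  moreover have "v \<in> B" by (simp add: B_def)
  ultimately show ?thesis using that by blast
qed

text \<open>
Only the edge between the old and the new root changes its direction; everything outside the branch
of $v$ is lifted above $v$ in rank.
\<close>
lemma reroot_at_child:
  assumes "rooted_tree E W u p h" "sym E" "v \<in> W" "v \<noteq> u" "p v = u"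
  shows "\<exists>h'. rooted_tree E W v (p(u := v)) h'"
    and "tree_arcs W v (p(u := v)) = tree_arcs W u p"
proof -
  note T = rooted_treeD[OF assms(1)]
  obtain B where B: "v \<in> B" "u \<notin> B" "\<And>x. x \<in> W - {u, v} \<Longrightarrow> x \<in> B \<longleftrightarrow> p x \<in> B"
    using branch_exists[OF assms(1,3,4)] by metis
  define h' where "h' x = (if x \<in> B then h x else h x + h v + 1)" for x
  have "(u, v) \<in> E"
    using T(4)[OF assms(3,4)] assms(2,5) by (auto dest: symD)
  then have "rooted_tree E W v (p(u := v)) h'"
    using T assms(3) B by (auto simp: rooted_tree_def h'_def)
  then show "\<exists>h'. rooted_tree E W v (p(u := v)) h'" by blast
  show "tree_arcs W v (p(u := v)) = tree_arcs W u p"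
    using assms(3-5) T(2) by (auto simp: tree_arcs_def split: if_splits)
qed

text \<open>
By induction along the path from $u$ to the old root: the root is first moved to the parent of $u$
and then across one more edge. The set of arcs has to be carried along, because it shows that the
tree rooted at $p(u)$ still contains the edge to $u$.
\<close>
lemma reroot:
  assumes "rooted_tree E W r p h" "sym E" "u \<in> W"
  shows "\<exists>p' h'. rooted_tree E W u p' h' \<and> tree_arcs W u p' = tree_arcs W r p"
  using assms(3)
proof (induction "h u" arbitrary: u rule: less_induct)
  case less
  note T = rooted_treeD[OF assms(1)]
  show ?case
  proof (cases "u = r")
    case True
    then show ?thesis using assms(1) by blast
  next
    case False
    then obtain p' h' where *: "rooted_tree E W (p u) p' h'"
      "tree_arcs W (p u) p' = tree_arcs W r p"
      using less T by blast
    have ne: "u \<noteq> p u" using T(5)[OF less.prems False] by auto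
    have "(u, p u) \<in> tree_arcs W (p u) p'"
      unfolding *(2) using False less.prems by (simp add: tree_arcs_def)
    then have "p' u = p u"
      by (auto simp: tree_arcs_def)
    then show ?thesis
      using reroot_at_child[OF *(1) assms(2) less.prems ne] *(2) by metis
  qed
qed

lemma has_tree_rooted_at:
  assumes "has_tree E W L" "sym E" "u \<in> W"
  obtains p h where "rooted_tree E W u p h" "L = {x \<in> W. tree_degree W u p x = 1}"
proof -
  from assms(1) obtain r p h where *: "rooted_tree E W r p h"
    "L = {x \<in> W. tree_degree W r p x = 1}"
    by (auto simp: has_tree_def)
  from reroot[OF *(1) assms(2,3)] obtain p' h' where
    "rooted_tree E W u p' h'" "tree_arcs W u p' = tree_arcs W r p" by blast
  with *(2) show ?thesis
    by (intro that[of p' h']) (simp_all add: tree_degree_def)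
qed

lemma card_exchange:
  assumes "finite A" "v \<in> A" "w \<notin> A"
  shows "card (insert w (A - {v})) = card A"
  using assms by (metis Diff_iff card_Suc_Diff1 card_insert_disjoint finite_Diff)

text \<open>
The exchange step: $v$ is a child of the root $u$, and $w$ lies outside the branch $B$ of $v$. The
edges $uv$ and $wp(w)$ are replaced by $uw$ and $vp(w)$, so $w$ becomes a child of $u$ and $v$
becomes a child of $p(w)$. Each of $u$ and $p(w)$ loses one child and gains another, which keeps all
degrees and in particular all leaves. Lifting the ranks in $B$ makes room for the branch
below $p(w)$.
\<close>
lemma has_tree_swap:
  assumes T: "rooted_tree (insert (u, v) (insert (v, u) E)) W u p h"
    and v: "v \<in> W" "v \<noteq> u" "p v = u"
    and E: "(u, v) \<notin> E" "(v, u) \<notin> E" "sym E"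
    and B: "v \<in> B" "u \<notin> B" "\<And>x. x \<in> W - {u, v} \<Longrightarrow> x \<in> B \<longleftrightarrow> p x \<in> B"
    and w: "w \<in> W" "w \<noteq> u" "w \<notin> B" "p w \<noteq> u" "(w, u) \<in> E" "(p w, v) \<in> E"
  shows "has_tree E W {x \<in> W. tree_degree W u p x = 1}"
proof -
  note TD = rooted_treeD[OF T]
  define p' where "p' = p(w := u, v := p w)"
  define h' where "h' x = (if x \<in> B then h x + h (p w) + 1 else h x)" for x
  have wv: "w \<noteq> v" using w(3) B(1) by auto
  have pw: "p w \<in> W" "p w \<notin> B"
    using TD(3) w B(3)[of w] wv by auto
  have p_in_E: "(x, p x) \<in> E" if "x \<in> W" "x \<noteq> u" "x \<noteq> v" for x
    using TD(4)[OF that(1,2)] that by auto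
  have T': "rooted_tree E W u p' h'"
    unfolding rooted_tree_def
  proof (intro conjI ballI)
    show "finite W" "u \<in> W" using TD by auto
    fix x assume x: "x \<in> W - {u}"
    consider "x = v" | "x = w" | "x \<noteq> v" "x \<noteq> w" by blast
    then have "p' x \<in> W \<and> (x, p' x) \<in> E \<and> h' (p' x) < h' x"
    proof cases
      case 1
      then show ?thesis
        using pw w(6) E(3) B(1) TD(5)[OF v(1,2)] by (auto simp: p'_def h'_def dest: symD)
    next
      case 2
      then show ?thesis
        using wv w TD(2) B(2) root_rank_less[OF T w(1,2)] by (auto simp: p'_def h'_def)
    next
      case 3
      then have "x \<in> B \<longleftrightarrow> p x \<in> B" using B(3)[of x] x by auto
      then show ?thesis
        using 3 x TD p_in_E by (auto simp: p'_def h'_def)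
    qed
    then show "p' x \<in> W" "(x, p' x) \<in> E" "h' (p' x) < h' x" by auto
  qed
  have "card (children W u p' x) = card (children W u p x)" for x
  proof -
    have fin: "finite (children W u p x)" for x
      using TD(1) by (auto simp: children_def)
    consider "x = u" | "x = p w" | "x \<noteq> u" "x \<noteq> p w" by blast
    then show ?thesis
    proof cases
      case 1
      have eq: "children W u p' u = insert w (children W u p u - {v})"
        using w(1,2,4) wv v by (auto simp: children_def p'_def split: if_splits)
      have "w \<notin> children W u p u" "v \<in> children W u p u"
        using w v by (auto simp: children_def)
      then show ?thesis
        unfolding 1 eq using fin[of u] by (intro card_exchange)
    next
      case 2
      have eq: "children W u p' (p w) = insert v (children W u p (p w) - {w})"
        using w(1,2,4) wv v by (auto simp: children_def p'_def split: if_splits)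
      have "v \<notin> children W u p (p w)" "w \<in> children W u p (p w)"
        using w v by (auto simp: children_def)
      then show ?thesis
        unfolding 2 eq using fin[of "p w"] by (intro card_exchange)
    next
      case 3
      then have "children W u p' x = children W u p x"
        using v by (auto simp: children_def p'_def)
      then show ?thesis by simp
    qed
  qed
  then have "tree_degree W u p' x = tree_degree W u p x" if "x \<in> W" for x
    using tree_degree_eq[OF T that] tree_degree_eq[OF T' that] by simp
  then have "{x \<in> W. tree_degree W u p x = 1} = {x \<in> W. tree_degree W u p' x = 1}" by auto
  with T' show ?thesis
    unfolding has_tree_def by blast
qed


text \<open>
The closure property. Suppose no exchange is possible. Let $W$ and $Z$ be the sets of
neighbours of $u$ or $v$ as below, so that $D(u) + D(v) = |W| + |Z|$. A parent of a
vertex of $W$ is $u$, $v$ or outside $Z$; with $Q$ the set of such parents other than $u$ and $v$ this gives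
$|Q| + |Z| \leq n - 2$. An inner vertex outside $Q$ has a child, and that child is not in $W$;
so at most $n - 2 - |W|$ inner vertices other than $u$ and $v$ are outside $Q$. There are at least
$n - 2 - k$ inner vertices other than $u$ and $v$, and the sum of the two bounds yields
$|W| + |Z| \leq n + k - 2$.
\<close>
lemma has_tree_remove_edge:
  assumes V: "finite V" and E: "E \<subseteq> V \<times> V" "sym E" "irrefl E"
    and uv: "u \<in> V" "v \<in> V" "u \<noteq> v" "(u, v) \<notin> E"
    and deg: "card V + k \<le> card (E `` {u}) + card (E `` {v}) + 1"
    and S: "has_tree (insert (u, v) (insert (v, u) E)) V S" "card S = k"
  shows "has_tree E V S"
proof (rule ccontr)
  assume neg: "\<not> has_tree E V S"
  let ?F = "insert (u, v) (insert (v, u) E)"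
  have symF: "sym ?F" using E(2) by (auto simp: sym_def)
  have vu: "(v, u) \<notin> E" using uv(4) E(2) by (auto dest: symD)
  obtain p h where T: "rooted_tree ?F V u p h" and leaves: "S = {x \<in> V. tree_degree V u p x = 1}"
    using has_tree_rooted_at[OF S(1) symF uv(1)] by metis
  note TD = rooted_treeD[OF T]
  have pv: "p v = u"
  proof (rule ccontr)
    assume "p v \<noteq> u"
    then have "(x, p x) \<in> E" if "x \<in> V" "x \<noteq> u" for x
      using TD(4)[OF that] that by auto
    then have "rooted_tree E V u p h"
      using TD by (auto simp: rooted_tree_def)
    then show False
      using neg leaves unfolding has_tree_def by blast
  qed
  obtain B where B: "v \<in> B" "u \<notin> B" "\<And>x. x \<in> V - {u, v} \<Longrightarrow> x \<in> B \<longleftrightarrow> p x \<in> B"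
    using branch_exists[OF T uv(2) uv(3)[symmetric]] by metis
  \<comment> \<open>Rooting the same tree at \<open>v\<close> exchanges the roles of the two components.\<close>
  obtain h2 where T2: "rooted_tree ?F V v (p(u := v)) h2"
    and arcs2: "tree_arcs V v (p(u := v)) = tree_arcs V u p"
    using reroot_at_child[OF T symF uv(2) uv(3)[symmetric] pv] by blast
  have leaves2: "S = {x \<in> V. tree_degree V v (p(u := v)) x = 1}"
    using leaves arcs2 by (simp add: tree_degree_def)
  have no_swap_u: "(p w, v) \<notin> E"
    if "w \<in> V" "w \<noteq> u" "w \<notin> B" "p w \<noteq> u" "(w, u) \<in> E" for w
    using has_tree_swap[OF T uv(2) uv(3)[symmetric] pv uv(4) vu E(2) B that] neg leaves by auto
  have no_swap_v: "(p w, u) \<notin> E"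
    if "w \<in> V" "w \<noteq> v" "w \<in> B" "p w \<noteq> v" "(w, v) \<in> E" for w
  proof
    assume *: "(p w, u) \<in> E"
    \<comment> \<open>The complement of \<open>B\<close> is the branch of \<open>u\<close> when \<open>v\<close> is the root.\<close>
    have F': "insert (v, u) (insert (u, v) E) = ?F" by auto
    have "w \<noteq> u" using that(3) B(2) by auto
    have "has_tree E V {x \<in> V. tree_degree V v (p(u := v)) x = 1}"
      by (rule has_tree_swap[where B = "- B" and u = v and v = u and w = w and h = h2])
        (use T2 uv vu E B that * \<open>w \<noteq> u\<close> in \<open>auto simp: F'\<close>)
    then show False using neg leaves2 by simp
  qed
  \<comment> \<open>\<open>W\<close> collects the neighbours that \<open>u\<close> and \<open>v\<close> have in their own components, the candidates for
    \<open>w\<close> in an exchange; \<open>Z\<close> collects those in the other component, the candidates for \<open>p w\<close>.\<close>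
  define I where "I = V - {u, v}"
  define W where "W = {w \<in> I. (w \<in> B \<and> (w, v) \<in> E) \<or> (w \<notin> B \<and> (w, u) \<in> E)}"
  define Z where "Z = {x \<in> I. (x \<in> B \<and> (x, u) \<in> E) \<or> (x \<notin> B \<and> (x, v) \<in> E)}"
  define Q where "Q = p ` W - {u, v}"
  have finI: "finite I" using V by (simp add: I_def)
  have cardI: "card I = card V - 2" "2 \<le> card V"
    using V uv card_mono[of V "{u, v}"] by (auto simp: I_def card_Diff_subset)
  have nu: "E `` {u} = (W - B) \<union> (Z \<inter> B)"
    using E uv vu by (auto simp: W_def Z_def I_def irrefl_def dest: symD)
  have nv: "E `` {v} = (W \<inter> B) \<union> (Z - B)"
    using E uv vu by (auto simp: W_def Z_def I_def irrefl_def dest: symD)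
  have finW: "finite W" and finZ: "finite Z"
    using finI by (simp_all add: W_def Z_def)
  have "card (E `` {u}) = card (W - B) + card (Z \<inter> B)"
    unfolding nu using finW finZ by (intro card_Un_disjoint) auto
  moreover have "card (E `` {v}) = card (W \<inter> B) + card (Z - B)"
    unfolding nv using finW finZ by (intro card_Un_disjoint) auto
  ultimately have sum: "card (E `` {u}) + card (E `` {v}) = card W + card Z"
    using finW finZ card_Int_Diff[of W B] card_Int_Diff[of Z B] by simp
  have WI: "W \<subseteq> I" by (auto simp: W_def)
  have pI: "p w \<in> V" if "w \<in> I" for w
    using TD(3)[of w] that by (auto simp: I_def)
  have "Q \<subseteq> I - Z"
  proof
    fix x assume "x \<in> Q"
    then obtain w where w: "w \<in> W" "x = p w" "p w \<noteq> u" "p w \<noteq> v" by (auto simp: Q_def)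
    then have wI: "w \<in> I" "w \<in> V" "w \<noteq> u" "w \<noteq> v" by (auto simp: W_def I_def)
    have "p w \<in> B \<longleftrightarrow> w \<in> B" using B(3) wI by auto
    then have "p w \<notin> Z"
      using no_swap_u[of w] no_swap_v[of w] w wI by (auto simp: W_def Z_def)
    moreover have "p w \<in> I" using pI[OF wI(1)] w by (simp add: I_def)
    ultimately show "x \<in> I - Z" using w by simp
  qed
  moreover have "Z \<subseteq> I" by (auto simp: Z_def)
  ultimately have bound1: "card Q + card Z \<le> card I"
    using finI card_mono[of "I - Z" Q] card_mono[of I Z] finZ by (simp add: card_Diff_subset)
  \<comment> \<open>An inner vertex outside \<open>Q\<close> has a child, and that child lies outside \<open>W\<close>.\<close>
  have "(I - S) - Q \<subseteq> p ` (I - W)"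
  proof
    fix x assume x: "x \<in> (I - S) - Q"
    then have "x \<in> V" "x \<noteq> u" "x \<noteq> v" "tree_degree V u p x \<noteq> 1"
      using leaves by (auto simp: I_def)
    then have "children V u p x \<noteq> {}"
      using tree_degree_eq[OF T, of x] by (auto simp del: One_nat_def)
    then obtain w where w: "w \<in> V" "w \<noteq> u" "p w = x" by (auto simp: children_def)
    then have "w \<in> I" using pv \<open>x \<noteq> u\<close> by (auto simp: I_def)
    moreover have "w \<notin> W"
      using x w \<open>x \<noteq> u\<close> \<open>x \<noteq> v\<close> by (auto simp: Q_def)
    ultimately show "x \<in> p ` (I - W)" using w by auto
  qed
  then have "card ((I - S) - Q) \<le> card (I - W)"
    using finI by (meson card_image_le card_mono finite_Diff finite_imageI le_trans)
  moreover have "card (I - W) = card I - card W" "card W \<le> card I"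
    using WI finI finW by (auto simp: card_Diff_subset card_mono)
  moreover have finS: "finite S" using leaves V by simp
  moreover have "card (I - S) \<le> card ((I - S) - Q) + card Q"
    using finW card_Un_le[of "(I - S) - Q" Q] card_mono[of "((I - S) - Q) \<union> Q" "I - S"] finI
    by (auto simp: Q_def)
  moreover have "card I \<le> card (I - S) + card S"
    using diff_card_le_card_Diff[OF finS, of I] by simp
  ultimately show False
    using sum bound1 deg S(2) cardI by linarith
qed

section \<open>Growing spanning trees in graphs with many dominating vertices\<close>

lemma has_tree_edge:
  assumes "(y, x) \<in> E" "x \<noteq> y"
  shows "has_tree E {x, y} {x, y}"
proof -
  let ?h = "\<lambda>z. if z = x then 0 else 1 :: nat"
  have T: "rooted_tree E {x, y} x (\<lambda>_. x) ?h"
    using assms by (auto simp: rooted_tree_def)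
  have "children {x, y} x (\<lambda>_. x) x = {y}" "children {x, y} x (\<lambda>_. x) y = {}"
    using assms(2) by (auto simp: children_def)
  then have "{z \<in> {x, y}. tree_degree {x, y} x (\<lambda>_. x) z = 1} = {x, y}"
    using tree_degree_eq[OF T] assms(2) by auto
  then show ?thesis by (rule has_treeI[OF T])
qed

lemma has_tree_star:
  assumes "finite Y" "2 \<le> card Y" "x \<notin> Y" "\<And>y. y \<in> Y \<Longrightarrow> (y, x) \<in> E"
  shows "has_tree E (insert x Y) Y"
proof -
  let ?h = "\<lambda>z. if z = x then 0 else 1 :: nat"
  have T: "rooted_tree E (insert x Y) x (\<lambda>_. x) ?h"
    using assms by (auto simp: rooted_tree_def)
  have "children (insert x Y) x (\<lambda>_. x) x = Y"
    "\<And>y. y \<in> Y \<Longrightarrow> children (insert x Y) x (\<lambda>_. x) y = {}"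
    using assms(3) by (auto simp: children_def)
  then have "{z \<in> insert x Y. tree_degree (insert x Y) x (\<lambda>_. x) z = 1} = Y"
    using tree_degree_eq[OF T] assms(2,3) by auto
  then show ?thesis by (rule has_treeI[OF T])
qed

text \<open>
A vertex that is not the root has a parent. Choosing the root away from $x$ therefore avoids a case
distinction whenever an edge at $x$ is needed.
\<close>
lemma has_tree_rooted_elsewhere:
  assumes "has_tree E W L" "sym E" "2 \<le> card W"
  obtains r p h where "rooted_tree E W r p h" "L = {z \<in> W. tree_degree W r p z = 1}" "r \<noteq> x"
proof -
  have "\<not> W \<subseteq> {x}"
    using assms(3) card_mono[of "{x}" W] by auto
  then obtain r where r: "r \<in> W" "r \<noteq> x" by auto
  show ?thesis
    using has_tree_rooted_at[OF assms(1,2) r(1)] r(2) that by metis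
qed

lemma has_tree_add_leaf:
  assumes "has_tree E W L" "sym E" "2 \<le> card W" "x \<in> W" "y \<notin> W" "(y, x) \<in> E"
  shows "has_tree E (insert y W) (insert y (L - {x}))"
proof -
  obtain r p h where T: "rooted_tree E W r p h" and L: "L = {z \<in> W. tree_degree W r p z = 1}"
    and r: "r \<noteq> x"
    using has_tree_rooted_elsewhere[OF assms(1-3)] by metis
  note TD = rooted_treeD[OF T]
  let ?p = "p(y := x)" and ?W = "insert y W"
  have ry: "r \<noteq> y" using TD(2) assms(5) by auto
  have xy: "x \<noteq> y" using assms(4,5) by auto
  have T': "rooted_tree E ?W r ?p (h(y := h x + 1))"
    using TD assms(4-6) by (auto simp: rooted_tree_def)
  have "children ?W r ?p x = insert y (children W r p x)"
    using assms(5) ry by (auto simp: children_def)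
  moreover have "finite (children W r p x)" "y \<notin> children W r p x"
    using TD(1) assms(5) by (auto simp: children_def)
  ultimately have dx: "tree_degree ?W r ?p x = tree_degree W r p x + 1"
    using tree_degree_eq[OF T, of x] tree_degree_eq[OF T', of x] assms(4) by simp
  have dx0: "tree_degree W r p x \<ge> 1"
    using tree_degree_eq[OF T, of x] assms(4) r by simp
  have "children ?W r ?p y = {}"
    using TD(3) assms(5) xy by (auto simp: children_def)
  then have dy: "tree_degree ?W r ?p y = 1"
    using tree_degree_eq[OF T', of y] ry by simp
  have "tree_degree ?W r ?p z = tree_degree W r p z" if "z \<in> W" "z \<noteq> x" for z
  proof -
    have "children ?W r ?p z = children W r p z"
      using that assms(5) by (auto simp: children_def)
    then show ?thesis
      using tree_degree_eq[OF T, of z] tree_degree_eq[OF T', of z] that by simp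
  qed
  then have "insert y (L - {x}) = {z \<in> ?W. tree_degree ?W r ?p z = 1}"
    using dx dx0 dy L assms(5) by (auto, metis Suc_n_not_le_n)
  with T' show ?thesis unfolding has_tree_def by blast
qed

lemma has_tree_subdivide:
  assumes T: "rooted_tree E W r p h" and E: "sym E"
    and a: "a \<in> W" "a \<noteq> r" and y: "y \<notin> W" "(y, a) \<in> E" "(y, p a) \<in> E"
  shows "has_tree E (insert y W) {z \<in> W. tree_degree W r p z = 1}"
proof -
  note TD = rooted_treeD[OF T]
  let ?p = "p(a := y, y := p a)" and ?W = "insert y W"
  \<comment> \<open>Doubling the ranks leaves a free value between those of \<open>p a\<close> and \<open>a\<close>.\<close>
  let ?h = "\<lambda>z. if z = y then 2 * h a - 1 else 2 * h z"
  have ry: "r \<noteq> y" using TD(2) y by auto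
  have ay: "a \<noteq> y" using a y by auto
  have pa: "p a \<in> W" "p a \<noteq> a" "p a \<noteq> y" "h (p a) < h a" using TD(3,5)[OF a] y by auto
  have T': "rooted_tree E ?W r ?p ?h"
    unfolding rooted_tree_def
  proof (intro conjI ballI)
    show "finite ?W" "r \<in> ?W" using TD by auto
    fix z assume z: "z \<in> ?W - {r}"
    consider "z = y" | "z = a" | "z \<in> W" "z \<noteq> y" "z \<noteq> a" using z by blast
    then have "?p z \<in> ?W \<and> (z, ?p z) \<in> E \<and> ?h (?p z) < ?h z"
    proof cases
      case 1 then show ?thesis using pa y ay by auto
    next
      case 2 then show ?thesis using pa y ay E by (auto dest: symD)
    next
      case 3
      then have "p z \<noteq> y" using TD(3) z y(1) by blast
      with 3 show ?thesis using TD z y by auto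
    qed
    then show "?p z \<in> ?W" "(z, ?p z) \<in> E" "?h (?p z) < ?h z" by auto
  qed
  have "children ?W r ?p y = {a}"
    using TD(3) a y ay pa by (auto simp: children_def)
  then have dy: "tree_degree ?W r ?p y = 2"
    using tree_degree_eq[OF T', of y] ry by simp
  have "tree_degree ?W r ?p z = tree_degree W r p z" if "z \<in> W" for z
  proof -
    have zy: "z \<noteq> y" using that y by auto
    have "card (children ?W r ?p z) = card (children W r p z)"
    proof (cases "z = p a")
      case True
      have "children ?W r ?p z = insert y (children W r p z - {a})"
        using True ry ay y(1) a pa by (auto simp: children_def split: if_splits)
      moreover have "a \<in> children W r p z" "y \<notin> children W r p z" "finite (children W r p z)"
        using True a y TD(1) by (auto simp: children_def)
      ultimately show ?thesis by (metis card_exchange)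
    next
      case False
      then have "children ?W r ?p z = children W r p z"
        using y(1) zy by (auto simp: children_def)
      then show ?thesis by simp
    qed
    then show ?thesis
      using tree_degree_eq[OF T, of z] tree_degree_eq[OF T', of z] that by simp
  qed
  then have "{z \<in> ?W. tree_degree ?W r ?p z = 1} = {z \<in> W. tree_degree W r p z = 1}"
    using dy y(1) by auto
  then show ?thesis by (rule has_treeI[OF T'])
qed

text \<open>
Every tree neighbour of $a$ is adjacent to $y$, so $y$ can subdivide any tree edge at $a$; it then
has degree two and the leaves stay the same.
\<close>
lemma has_tree_insert_twin:
  assumes "has_tree E W L" "sym E" "2 \<le> card W"
    and "a \<in> W" "y \<notin> W" "(y, a) \<in> E" "\<And>z. z \<in> W \<Longrightarrow> (a, z) \<in> E \<Longrightarrow> (y, z) \<in> E"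
  shows "has_tree E (insert y W) L"
proof -
  obtain r p h where T: "rooted_tree E W r p h" and L: "L = {z \<in> W. tree_degree W r p z = 1}"
    and r: "r \<noteq> a"
    using has_tree_rooted_elsewhere[OF assms(1-3)] by metis
  show ?thesis
    unfolding L using has_tree_subdivide[OF T assms(2,4) r[symmetric] assms(5,6)]
      assms(7) rooted_treeD(3,4)[OF T assms(4) r[symmetric]] by blast
qed

lemma has_tree_insert_twins:
  assumes "finite D"
    and "has_tree E W L" "sym E" "2 \<le> card W" "finite W" "D \<inter> W = {}"
    and "a \<in> W" "\<And>y. y \<in> D \<Longrightarrow> (y, a) \<in> E"
    and "\<And>y z. y \<in> D \<Longrightarrow> z \<in> W \<union> D \<Longrightarrow> (a, z) \<in> E \<Longrightarrow> y \<noteq> z \<Longrightarrow> (y, z) \<in> E"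
  shows "has_tree E (W \<union> D) L"
  using assms(1,6,8,9)
proof (induction D rule: finite_induct)
  case empty
  then show ?case using assms(2) by simp
next
  case (insert y D)
  have "has_tree E (W \<union> D) L"
    using insert.prems by (intro insert.IH) auto
  moreover have "2 \<le> card (W \<union> D)"
    using assms(4,5) insert.hyps card_mono[of "W \<union> D" W] by simp
  ultimately have "has_tree E (insert y (W \<union> D)) L"
    using assms(3,7) insert.hyps insert.prems
    by (intro has_tree_insert_twin[where a = a]) auto
  then show ?case by simp
qed

text \<open>
Starting from the leaf $l$, the tree is prolonged by a path that alternates between $A$ and $B$ and
ends in $B$. This moves one leaf and keeps the others.
\<close>
lemma has_tree_zigzag:
  assumes "finite A" "card B = card A" "finite B"
    and "has_tree E W L" "sym E" "2 \<le> card W" "finite W" "l \<in> L"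
    and "A \<inter> B = {}" "(A \<union> B) \<inter> W = {}"
    and "\<And>a b. a \<in> A \<Longrightarrow> b \<in> insert l B \<Longrightarrow> (a, b) \<in> E"
  shows "\<exists>l'\<in>insert l B. has_tree E (W \<union> A \<union> B) (insert l' (L - {l}))"
  using assms(1-3,9-)
proof (induction A arbitrary: B rule: finite_induct)
  case empty
  then have "B = {}" by simp
  then show ?case using assms(4,8) by (auto simp: insert_absorb)
next
  case (insert a A)
  then have "B \<noteq> {}" by auto
  then obtain b B' where B: "B = insert b B'" "b \<notin> B'" by (meson Set.set_insert all_not_in_conv)
  have fin: "finite B'" "finite A" using insert B by auto
  have "\<exists>l'\<in>insert l B'. has_tree E (W \<union> A \<union> B') (insert l' (L - {l}))"
  proof (rule insert.IH)
    show "card B' = card A" using insert.prems(1,2) insert.hyps B fin by simp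
    show "A \<inter> B' = {}" "(A \<union> B') \<inter> W = {}" using insert.prems(3,4) B by auto
    show "(x, y) \<in> E" if "x \<in> A" "y \<in> insert l B'" for x y
      using insert.prems(5)[of x y] that B(1) by blast
  qed (rule fin)
  then obtain l' where l': "l' \<in> insert l B'" "has_tree E (W \<union> A \<union> B') (insert l' (L - {l}))"
    by blast
  have lW: "L \<subseteq> W" using has_tree_leaves_subset[OF assms(4)] .
  let ?W = "W \<union> A \<union> B'"
  have card: "2 \<le> card ?W"
    using le_trans[OF assms(6) card_mono[of ?W W]] assms(7) fin by auto
  have "(a, b) \<in> E" using insert.prems B by auto
  then have ba: "(b, a) \<in> E" using assms(5) by (auto dest: symD)
  have a: "a \<notin> ?W" "(a, l') \<in> E" "l' \<in> ?W" "b \<notin> insert a ?W"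
    using insert l'(1) B lW assms(8) by auto
  have t1: "has_tree E (insert a ?W) (insert a (insert l' (L - {l}) - {l'}))"
    by (rule has_tree_add_leaf[OF l'(2) assms(5) card a(3,1,2)])
  have c1: "2 \<le> card (insert a ?W)"
    using card a(1) fin assms(7) by simp
  have "has_tree E (insert b (insert a ?W))
      (insert b (insert a (insert l' (L - {l}) - {l'}) - {a}))"
    by (rule has_tree_add_leaf[OF t1 assms(5) c1 insertI1 a(4) ba])
  moreover have "insert b (insert a (insert l' (L - {l}) - {l'}) - {a}) = insert b (L - {l})"
  proof -
    have "a \<notin> L" "l' \<notin> L - {l}"
      using lW a(1) l'(1) insert.prems(4) B(1) by blast+
    then show ?thesis by blast
  qed
  moreover have "insert b (insert a ?W) = W \<union> insert a A \<union> B"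
    using B by auto
  ultimately have "has_tree E (W \<union> insert a A \<union> B) (insert b (L - {l}))"
    by (simp only:)
  moreover have "b \<in> insert l B" using B(1) by blast
  ultimately show ?case by blast
qed

text \<open>
Once all remaining vertices are hung on as leaves, a leaf of the old tree survives only if nothing
is attached to it.
\<close>
lemma has_tree_attach:
  assumes "finite S" "has_tree E W L" "sym E" "2 \<le> card W" "finite W" "S \<inter> W = {}"
    and "\<And>s. s \<in> S \<Longrightarrow> g s \<in> W" "\<And>s. s \<in> S \<Longrightarrow> (s, g s) \<in> E"
  shows "has_tree E (W \<union> S) ((L - g ` S) \<union> S)"
  using assms(1,6-)
proof (induction S rule: finite_induct)
  case empty
  then show ?case using assms(2) by simp
next
  case (insert s S)
  have "has_tree E (W \<union> S) ((L - g ` S) \<union> S)"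
    using insert by auto
  moreover have "2 \<le> card (W \<union> S)"
    using assms(4,5) insert.hyps card_mono[of "W \<union> S" W] by simp
  ultimately have "has_tree E (insert s (W \<union> S)) (insert s ((L - g ` S) \<union> S - {g s}))"
    using assms(3) insert by (intro has_tree_add_leaf) auto
  moreover have "insert s ((L - g ` S) \<union> S - {g s}) = (L - g ` insert s S) \<union> insert s S"
    using insert.prems by auto
  ultimately show ?case by simp
qed

text \<open>
The tree is built on the complement of $S$ first, with few leaves, and the vertices of $S$ are then
attached such that each of these leaves receives one of them. Let $X'$ be the part of $X$
outside $S$ and let $Y$ contain one vertex from each clique that remains outside $X$ and $S$.

If $|Y| < |X'|$, a path through $Y$ starts and ends in $X'$, and every vertex of $S$ can be attached
to either end. If $|Y| = |X'|$, one end of the path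
lies in $Y$. If $|Y| > |X'|$, the path is replaced
by a star with $|Y| - |X'| + 1$ leaves, one of which is prolonged by a zigzag through the rest of
$X'$ and $Y$. Leaves in $Y$ can only be covered by vertices of $S \<inter> X$, and
$|Y| \leq |P| + 1 < |X| = |X'| + |S \<inter> X|$ says that there are enough of them.
The rest of $X'$ and of the clique is inserted by subdividing edges.
\<close>
lemma split_graph_has_tree:
  assumes fin: "finite X" "finite M" "finite P"
    and disj: "X \<inter> M = {}" "X \<inter> P = {}" "M \<inter> P = {}"
    and E: "sym E"
    and dom: "\<And>x y. x \<in> X \<Longrightarrow> y \<in> X \<union> M \<union> P \<Longrightarrow> x \<noteq> y \<Longrightarrow> (x, y) \<in> E"
    and clique: "\<And>x y. x \<in> M \<Longrightarrow> y \<in> M \<Longrightarrow> x \<noteq> y \<Longrightarrow> (x, y) \<in> E"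
    and sep: "\<And>x y. x \<in> M \<Longrightarrow> y \<in> P \<Longrightarrow> (x, y) \<notin> E"
    and P: "card P + 2 \<le> card X"
    and S: "S \<subseteq> X \<union> M \<union> P" "2 \<le> card S" "card S < card X" "card S + 2 \<le> card (X \<union> M \<union> P)"
  shows "has_tree E (X \<union> M \<union> P) S"
proof -
  let ?V = "X \<union> M \<union> P"
  define X' where "X' = X - S"
  define M' where "M' = M - S"
  define P' where "P' = P - S"
  have fin': "finite X'" "finite M'" "finite P'" "finite S"
    using fin S(1) by (auto simp: X'_def M'_def P'_def intro: finite_subset)
  have domX': "(y, x) \<in> E" if "x \<in> X" "y \<in> ?V" "x \<noteq> y" for x y
    using dom[OF that] E by (auto dest: symD)
  have "\<not> X \<subseteq> S"
    using S(3) fin'(4) card_mono[of S X] by auto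
  then obtain x1 where x1: "x1 \<in> X'" by (auto simp: X'_def)
  \<comment> \<open>One vertex of \<open>M'\<close> suffices; the other ones are its twins and can be inserted afterwards.\<close>
  obtain Y where Y: "P' \<subseteq> Y" "Y \<subseteq> P' \<union> M'" "card Y \<le> card P + 1" "M' = {} \<or> Y \<inter> M' \<noteq> {}"
  proof (cases "M' = {}")
    case True
    then show ?thesis
      using that[of P'] fin card_mono[of P P'] by (auto simp: P'_def)
  next
    case False
    then obtain m0 where "m0 \<in> M'" by auto
    then show ?thesis
      using that[of "insert m0 P'"] fin card_mono[of P P'] card_insert_le_m1[of "card P + 1" P' m0]
      by (auto simp: P'_def)
  qed
  have finY: "finite Y" using Y(2) fin' by (auto intro: finite_subset)
  have disjY: "X' \<inter> Y = {}" "S \<inter> (X' \<union> Y) = {}"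
    using Y(2) disj by (auto simp: X'_def M'_def P'_def)
  have XY: "(x, y) \<in> E" "(y, x) \<in> E" if "x \<in> X'" "y \<in> Y" for x y
    using that dom[of x y] domX'[of x y] Y(2) disjY by (auto simp: X'_def M'_def P'_def)
  have XX: "(x, y) \<in> E" if "x \<in> X'" "y \<in> X'" "x \<noteq> y" for x y
    using that dom[of x y] by (auto simp: X'_def)
  have SX: "(s, x) \<in> E" if "x \<in> X'" "s \<in> S" for x s
    using that domX'[of x s] S(1) by (auto simp: X'_def)
  have cSX: "card (S \<inter> X) + card X' = card X"
    using fin card_Int_Diff[of X S] by (simp add: X'_def Int_commute)
  have SXY: "(s, y) \<in> E" if "s \<in> S \<inter> X" "y \<in> Y" for s y
    using that dom[of s y] Y(2) disj by (auto simp: M'_def P'_def)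
  have "\<exists>W L g. has_tree E W L \<and> 2 \<le> card W \<and> Y \<subseteq> W \<and> x1 \<in> W \<and> W \<subseteq> X' \<union> Y \<and>
     (\<forall>s\<in>S. g s \<in> W \<and> (s, g s) \<in> E) \<and> L \<subseteq> g ` S"
  proof -
    obtain s1 s2 where s12: "s1 \<in> S" "s2 \<in> S" "s1 \<noteq> s2"
      using S(2) by (metis card_2_iff' obtain_subset_with_card_n subsetD)
    have two: "\<exists>g. (\<forall>s\<in>S. g s \<in> W \<and> (s, g s) \<in> E) \<and> {x, x'} \<subseteq> g ` S"
      if "x \<in> X'" "x' \<in> X'" "x \<in> W" "x' \<in> W" for x x' W
      using that s12 SX by (intro exI[of _ "\<lambda>s. if s = s1 then x else x'"]) auto
    consider "Y = {}" | "Y \<noteq> {}" "card Y \<le> card X'" | "card X' < card Y" by linarith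
    then show ?thesis
    proof cases
      case 1
      then have "M' = {}" "P' = {}" using Y by auto
      then have "?V - S = X'" by (auto simp: X'_def M'_def P'_def)
      then have "2 \<le> card X'"
        using S(1,4) fin fin' card_Diff_subset[of S ?V] by auto
      then have "\<not> X' \<subseteq> {x1}"
        using card_mono[of "{x1}" X'] by auto
      then obtain x2 where x2: "x2 \<in> X'" "x2 \<noteq> x1" by auto
      then have t: "has_tree E {x1, x2} {x1, x2}"
        using x1 XX by (intro has_tree_edge) auto
      obtain g where g: "(\<forall>s\<in>S. g s \<in> {x1, x2} \<and> (s, g s) \<in> E) \<and> {x1, x2} \<subseteq> g ` S"
        using two[OF x1 x2(1), of "{x1, x2}"] by auto
      show ?thesis
        using t g 1 x1 x2 by (intro exI[of _ "{x1, x2}"] exI[of _ g]) auto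
    next
      case 2
      then obtain y1 where y1: "y1 \<in> Y" by auto
      have "card Y - 1 \<le> card (X' - {x1})" using 2 x1 fin' by simp
      then obtain A where A: "A \<subseteq> X' - {x1}" "card A = card Y - 1" "finite A"
        by (rule obtain_subset_with_card_n)
      have ne: "x1 \<noteq> y1" using disjY x1 y1 by auto
      have "\<exists>l'\<in>insert y1 (Y - {y1}). has_tree E ({x1, y1} \<union> A \<union> (Y - {y1}))
          (insert l' ({x1, y1} - {y1}))"
        by (rule has_tree_zigzag)
          (use A x1 y1 ne finY E disjY XY in \<open>auto intro: has_tree_edge\<close>)
      moreover have "{x1, y1} \<union> A \<union> (Y - {y1}) = insert x1 (A \<union> Y)" "insert y1 (Y - {y1}) = Y"
        "{x1, y1} - {y1} = {x1}"
        using y1 ne by auto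
      ultimately obtain l' where l': "l' \<in> Y" "has_tree E (insert x1 (A \<union> Y)) {l', x1}"
        by auto
      let ?W = "insert x1 (A \<union> Y)"
      have x1_ne: "l' \<noteq> x1" using l'(1) x1 disjY by auto
      have W2: "2 \<le> card ?W"
        using card_mono[of ?W "{x1, y1}"] A finY y1 ne by auto
      show ?thesis
      proof (cases "card Y = card X'")
        case True
        \<comment> \<open>Then \<open>S\<close> meets \<open>X\<close>, and such a vertex covers the leaf \<open>l'\<close>.\<close>
        then have "card (S \<inter> X) \<noteq> 0" using cSX Y(3) P by linarith
        then obtain s where s: "s \<in> S \<inter> X" by (metis card.empty ex_in_conv)
        then obtain s' where s': "s' \<in> S" "s' \<noteq> s" using s12 by metis
        define g where "g z = (if z = s then l' else x1)" for z
        have "\<forall>z\<in>S. g z \<in> ?W \<and> (z, g z) \<in> E"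
          using l'(1) s SXY SX x1 by (auto simp: g_def)
        moreover have "{l', x1} \<subseteq> g ` S"
          using s s' by (auto simp: g_def image_iff)
        ultimately show ?thesis
          using l' W2 A x1 by (intro exI[of _ ?W] exI[of _ "{l', x1}"] exI[of _ g]) auto
      next
        case False
        have "card (insert x1 A) < card X'"
          using 2 False A finY y1 by (auto simp: card_insert_if card_gt_0_iff)
        then have "\<not> X' \<subseteq> insert x1 A"
          using A(3) card_mono[of "insert x1 A" X'] by auto
        then obtain x where x: "x \<in> X'" "x \<notin> insert x1 A" by auto
        have "x \<notin> ?W" using x disjY by auto
        then have "has_tree E (insert x ?W) (insert x ({l', x1} - {l'}))"
          using l'(1) XY[OF x(1)] by (intro has_tree_add_leaf[OF l'(2) E W2]) auto
        then have t: "has_tree E (insert x ?W) {x, x1}"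
          using x1_ne by (simp add: insert_Diff_if)
        obtain g where g: "(\<forall>s\<in>S. g s \<in> insert x ?W \<and> (s, g s) \<in> E) \<and> {x, x1} \<subseteq> g ` S"
          using two[OF x(1) x1, of "insert x ?W"] by auto
        have "2 \<le> card (insert x ?W)"
          using W2 \<open>x \<notin> ?W\<close> A finY by (simp add: card_insert_if)
        with t g x A x1 show ?thesis
          by (intro exI[of _ "insert x ?W"] exI[of _ "{x, x1}"] exI[of _ g]) auto
      qed
    next
      case 3
      have m: "1 \<le> card X'" using x1 fin' by (auto simp: Suc_le_eq card_gt_0_iff)
      have "card Y - card X' + 1 \<le> card Y" using 3 m by linarith
      then obtain Y0 where Y0: "Y0 \<subseteq> Y" "card Y0 = card Y - card X' + 1" "finite Y0"
        by (rule obtain_subset_with_card_n)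
      have Y02: "2 \<le> card Y0" using Y0(2) 3 by linarith
      then obtain l where l: "l \<in> Y0" by fastforce
      have x1Y: "x1 \<notin> Y" using x1 disjY by auto
      have star: "has_tree E (insert x1 Y0) Y0"
        using Y0 Y02 x1Y XY[OF x1] by (intro has_tree_star) auto
      have cB: "card (Y - Y0) = card (X' - {x1})"
        using Y0 finY x1 fin' 3 m by (auto simp: card_Diff_subset)
      have "\<exists>l'\<in>insert l (Y - Y0). has_tree E (insert x1 Y0 \<union> (X' - {x1}) \<union> (Y - Y0))
          (insert l' (Y0 - {l}))"
      proof (rule has_tree_zigzag)
        show "2 \<le> card (insert x1 Y0)" using Y02 Y0 by (simp add: card_insert_if)
      qed (use star cB Y0 l finY E disjY XY x1Y fin' in auto)
      then obtain l' where l': "l' \<in> insert l (Y - Y0)"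
        "has_tree E (insert x1 Y0 \<union> (X' - {x1}) \<union> (Y - Y0)) (insert l' (Y0 - {l}))" by blast
      have W: "insert x1 Y0 \<union> (X' - {x1}) \<union> (Y - Y0) = X' \<union> Y"
        using Y0(1) x1 by auto
      let ?L = "insert l' (Y0 - {l})"
      have LY: "?L \<subseteq> Y" using l' l Y0 by auto
      have "l' \<notin> Y0 - {l}" using l' by auto
      then have "card ?L = card Y0" using Y0(3) l card_Suc_Diff1[of Y0 l] by simp
      then have "card ?L \<le> card (S \<inter> X)" using Y0(2) cSX Y(3) P 3 by linarith
      moreover have "finite (S \<inter> X)" "finite ?L" using fin Y0 by auto
      ultimately obtain e where e: "e ` ?L \<subseteq> S \<inter> X" "inj_on e ?L"
        using card_le_inj[of ?L "S \<inter> X"] by blast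
      \<comment> \<open>Vertices that are not needed to cover a leaf are attached to \<open>x1\<close>.\<close>
      define g where "g s = (if s \<in> e ` ?L then inv_into ?L e s else x1)" for s
      have "g s \<in> X' \<union> Y \<and> (s, g s) \<in> E" if s: "s \<in> S" for s
      proof (cases "s \<in> e ` ?L")
        case True
        then have "g s \<in> Y" "s \<in> S \<inter> X"
          using LY e(1) inv_into_into[OF True] by (auto simp: g_def simp del: insert_iff)
        then show ?thesis using SXY by blast
      next
        case False
        then show ?thesis using SX[OF x1 s] x1 by (simp add: g_def)
      qed
      moreover have "?L \<subseteq> g ` S"
      proof
        fix z assume z: "z \<in> ?L"
        then have "e z \<in> e ` ?L" by (rule imageI)
        then have "g (e z) = z" by (simp only: g_def if_True inv_into_f_f[OF e(2) z])
        moreover have "e z \<in> S" using e(1) z by blast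
        ultimately show "z \<in> g ` S" by (metis imageI)
      qed
      moreover have "2 \<le> card (X' \<union> Y)"
        using le_trans[OF Y02 card_mono[of "X' \<union> Y" Y0]] Y0 finY fin' by auto
      ultimately show ?thesis
        using l'(2) x1 unfolding W by (intro exI[of _ "X' \<union> Y"] exI[of _ ?L] exI[of _ g]) auto
    qed
  qed
  then obtain W L g where W: "has_tree E W L" "2 \<le> card W" "Y \<subseteq> W" "x1 \<in> W" "W \<subseteq> X' \<union> Y"
    and g: "\<forall>s\<in>S. g s \<in> W \<and> (s, g s) \<in> E" "L \<subseteq> g ` S" by blast
  have finW: "finite W" using W(5) fin' finY by (auto intro: finite_subset)
  have "has_tree E (W \<union> (X' - W)) L"
  proof (rule has_tree_insert_twins[where a = x1])
    fix y z assume y: "y \<in> X' - W" and z: "z \<in> W \<union> (X' - W)" "y \<noteq> z"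
    then have "z \<in> ?V" using W(5) Y(2) by (auto simp: X'_def M'_def P'_def)
    then show "(y, z) \<in> E" using dom[of y z] y z by (auto simp: X'_def)
  qed (use W finW fin' E XX x1 in auto)
  moreover have "W \<union> (X' - W) = X' \<union> Y" using W(3,5) by auto
  ultimately have W1: "has_tree E (X' \<union> Y) L" by simp
  have W1card: "2 \<le> card (X' \<union> Y)"
    using W card_mono[of "X' \<union> Y" W] fin' finY by simp
  have W2: "has_tree E (X' \<union> Y \<union> (M' - Y)) L"
  proof (cases "M' = {}")
    case True
    then show ?thesis using W1 by simp
  next
    case False
    then obtain m0 where m0: "m0 \<in> Y" "m0 \<in> M'" using Y(4) by auto
    show ?thesis
    proof (rule has_tree_insert_twins[where a = m0])
      fix y z assume y: "y \<in> M' - Y" and z: "z \<in> X' \<union> Y \<union> (M' - Y)" "(m0, z) \<in> E" "y \<noteq> z"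
      then have "z \<in> X' \<or> z \<in> M'"
        using sep[of m0 z] m0 Y(2) by (auto simp: M'_def P'_def)
      then show "(y, z) \<in> E"
        using y z clique[of y z] domX'[of z y] by (auto simp: M'_def X'_def)
    next
      show "(y, m0) \<in> E" if "y \<in> M' - Y" for y
        using that m0 clique[of y m0] by (auto simp: M'_def)
      show "(M' - Y) \<inter> (X' \<union> Y) = {}"
        using disj by (auto simp: M'_def X'_def)
    qed (use fin' finY m0(1) W1 W1card E in simp_all)
  qed
  let ?W = "X' \<union> Y \<union> (M' - Y)"
  have V_eq: "?W = ?V - S" using Y by (auto simp: X'_def M'_def P'_def)
  have "has_tree E (?W \<union> S) ((L - g ` S) \<union> S)"
  proof (rule has_tree_attach[OF fin'(4) W2 E, where g = g])
    show "2 \<le> card ?W"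
      using le_trans[OF W1card card_mono[of ?W "X' \<union> Y"]] fin' finY by simp
    show "finite ?W" using fin' finY by simp
    show "S \<inter> ?W = {}" unfolding V_eq by blast
    show "g s \<in> ?W" "(s, g s) \<in> E" if "s \<in> S" for s
      using g(1) that W(5) by blast+
  qed
  moreover have "?W \<union> S = ?V" unfolding V_eq using S(1) by blast
  moreover have "(L - g ` S) \<union> S = S" using g(2) by blast
  ultimately show ?thesis by simp
qed

section \<open>From parent functions to undirected trees\<close>

lemma (in pre_digraph) cas_consecutive:
  "cas u q v \<Longrightarrow> Suc i < length q \<Longrightarrow> tail G (q ! Suc i) = head G (q ! i)"
proof (induction u q v arbitrary: i rule: cas.induct)
  case (2 u e es v)
  then show ?case
    by (cases i; cases es) auto
qed simp

lemma (in pre_digraph) cas_last: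
  "cas u q v \<Longrightarrow> q \<noteq> [] \<Longrightarrow> head G (last q) = v"
  by (induction u q v rule: cas.induct) (auto split: if_splits)

text \<open>
On a cycle of length at least three the two neighbours of a vertex of largest rank are distinct,
but both would have to be its parent.
\<close>
lemma tree_arcs_acyclic:
  assumes T: "rooted_tree E W r p h" and GT: "parcs G = tree_arcs W r p"
    and c: "pre_digraph.cycle (with_proj G) c" "3 \<le> length c"
  shows False
proof -
  interpret pre_digraph "with_proj G" .
  obtain u where c1: "set c \<subseteq> tree_arcs W r p" "cas u c u" "distinct (tl (awalk_verts u c))"
    using c(1) GT by (auto simp: cycle_def awalk_def)
  let ?n = "length c"
  have ne: "c \<noteq> []" using c(2) by auto
  have dist: "distinct (map snd c)"
    using c1(3) ne by (simp add: awalk_verts_conv'[OF c1(2)])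
  define nx where "nx i = (if Suc i < ?n then Suc i else 0)" for i
  have nx: "fst (c ! nx i) = snd (c ! i)" if "i < ?n" for i
  proof (cases "Suc i < ?n")
    case True
    then show ?thesis using cas_consecutive[OF c1(2)] by (simp add: nx_def)
  next
    case False
    then have "i = ?n - 1" using that by linarith
    then have "c ! i = last c" using ne by (simp add: last_conv_nth)
    moreover have "fst (hd c) = u" using c1(2) ne by (simp add: cas_simp)
    ultimately show ?thesis using False cas_last[OF c1(2) ne] ne by (simp add: nx_def hd_conv_nth)
  qed
  \<comment> \<open>Both neighbours on the cycle of a vertex of largest rank are its parent.\<close>
  obtain j where j: "j < ?n" "\<And>i. i < ?n \<Longrightarrow> h (snd (c ! i)) \<le> h (snd (c ! j))"
  proof -
    have "finite ((\<lambda>i. h (snd (c ! i))) ` {..<?n})" "(\<lambda>i. h (snd (c ! i))) ` {..<?n} \<noteq> {}"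
      using ne by auto
    from Max_in[OF this] Max_ge[OF this(1)] show ?thesis
      using that by (smt (verit) imageE imageI lessThan_iff)
  qed
  obtain i where i: "i < ?n" "nx i = j"
  proof (cases j)
    case 0
    then show ?thesis using that[of "?n - 1"] ne by (simp add: nx_def)
  next
    case (Suc i)
    then show ?thesis using that[of i] j by (simp add: nx_def)
  qed
  have up: "a = p b" if "(a, b) \<in> tree_arcs W r p \<or> (b, a) \<in> tree_arcs W r p" "h a \<le> h b" for a b
    using that rooted_treeD(5)[OF T] by (auto simp: tree_arcs_def not_le[symmetric])
  have in_arcs: "c ! m \<in> tree_arcs W r p" if "m < ?n" for m
    using c1(1) that nth_mem by blast
  have nj: "nx j < ?n" using ne by (simp add: nx_def)
  have "snd (c ! i) = p (snd (c ! j))"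
    using up[of "snd (c ! i)" "snd (c ! j)"] in_arcs[OF j(1)] nx[OF i(1)] i j(2)[OF i(1)]
    by (metis prod.collapse)
  moreover have "snd (c ! nx j) = p (snd (c ! j))"
    using up[of "snd (c ! nx j)" "snd (c ! j)"] in_arcs[OF nj] nx[OF j(1)] j(2)[OF nj]
    by (metis prod.collapse)
  ultimately have "map snd c ! i = map snd c ! nx j" using i nj by simp
  then have "i = nx j"
    using dist i nj by (metis length_map nth_eq_iff_index_eq)
  then show False
    using i j c(2) by (auto simp: nx_def split: if_splits)
qed

lemma vertex_degree_eq: "vertex_degree G x = card (parcs G `` {x})"
proof -
  have "out_arcs (with_proj G) x = Pair x ` (parcs G `` {x})"
    by (auto simp: out_arcs_def)
  then show ?thesis by (simp add: out_degree_def card_image inj_on_def)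
qed

lemma has_tree_imp_spanning_tree:
  assumes G: "pair_graph G" and T: "has_tree (parcs G) (pverts G) S"
  shows "\<exists>T. undirected_tree T \<and> spanning (with_proj T) (with_proj G) \<and> tree_leaves T = S"
proof -
  obtain r p h where R: "rooted_tree (parcs G) (pverts G) r p h"
    and S: "S = {x \<in> pverts G. tree_degree (pverts G) r p x = 1}"
    using T by (auto simp: has_tree_def)
  note RD = rooted_treeD[OF R]
  define T where "T = \<lparr>pverts = pverts G, parcs = tree_arcs (pverts G) r p\<rparr>"
  have T_simps: "pverts T = pverts G" "parcs T = tree_arcs (pverts G) r p"
    by (simp_all add: T_def)
  have symG: "sym (parcs G)" using G by (simp add: pair_graph_iff)
  have sub: "parcs T \<subseteq> parcs G"
    using RD(4) symG by (auto simp: T_simps tree_arcs_def dest: symD)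
  have "irrefl (parcs T)" using G sub by (auto simp: pair_graph_iff irrefl_def)
  moreover have symT: "sym (parcs T)" by (auto simp: T_simps sym_def tree_arcs_def)
  moreover have "parcs T \<subseteq> pverts T \<times> pverts T"
    using RD(3) by (auto simp: T_simps tree_arcs_def)
  ultimately have pgT: "pair_graph T"
    using RD(1) by (simp add: pair_graph_iff T_simps)
  interpret T: pair_graph T by fact
  have reach: "x \<rightarrow>\<^sup>*\<^bsub>with_proj T\<^esub> r \<and> r \<rightarrow>\<^sup>*\<^bsub>with_proj T\<^esub> x" if "x \<in> pverts G" for x
    using that
  proof (induction "h x" arbitrary: x rule: less_induct)
    case less
    show ?case
    proof (cases "x = r")
      case True
      then show ?thesis using less.prems by (auto simp: T_simps)
    next
      case False
      then have "(x, p x) \<in> parcs T" "(p x, x) \<in> parcs T"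
        using less.prems by (auto simp: T_simps tree_arcs_def)
      then have "x \<rightarrow>\<^bsub>with_proj T\<^esub> p x" "p x \<rightarrow>\<^bsub>with_proj T\<^esub> x" by auto
      moreover have "p x \<rightarrow>\<^sup>*\<^bsub>with_proj T\<^esub> r \<and> r \<rightarrow>\<^sup>*\<^bsub>with_proj T\<^esub> p x"
        using less RD(3,5)[OF less.prems False] by blast
      ultimately show ?thesis
        using wf_digraph.adj_reachable_trans[OF T.wf_digraph_axioms, of x "p x" r]
          wf_digraph.reachable_adj_trans[OF T.wf_digraph_axioms, of r "p x" x] by simp
    qed
  qed
  have "strongly_connected (with_proj T)"
    unfolding strongly_connected_def
  proof (intro conjI ballI)
    show "verts (with_proj T) \<noteq> {}" using RD(2) by (auto simp: T_simps)
    fix x y assume "x \<in> verts (with_proj T)" "y \<in> verts (with_proj T)"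
    then show "x \<rightarrow>\<^sup>*\<^bsub>with_proj T\<^esub> y"
      using reach[of x] reach[of y] T.reachable_trans[of x r y] by (simp add: T_simps)
  qed
  moreover have "parcs (mk_symmetric (with_proj T)) = parcs T"
    using symT by (auto simp: parcs_mk_symmetric dest: symD)
  then have "mk_symmetric (with_proj T) = T" by simp
  ultimately have "Digraph_Component.connected (with_proj T)"
    by (simp add: Digraph_Component.connected_def)
  moreover have "\<not> (\<exists>c. pre_digraph.cycle (with_proj T) c \<and> 3 \<le> length c)"
    using tree_arcs_acyclic[OF R T_simps(2)] by blast
  ultimately have "undirected_tree T" using pgT by (simp add: undirected_tree_def)
  moreover have "spanning (with_proj T) (with_proj G)"
  proof -
    interpret G: pair_graph G by fact
    show ?thesis
      using sub T.wf_digraph_axioms G.wf_digraph_axioms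
      by (auto simp: spanning_def subgraph_def compatible_def T_simps)
  qed
  moreover have "vertex_degree T x = tree_degree (pverts G) r p x" for x
    by (simp add: vertex_degree_eq tree_degree_def T_simps)
  then have "tree_leaves T = S" by (simp add: tree_leaves_def S T_simps)
  ultimately show ?thesis by blast
qed

text \<open>
The property \<^const>\<open>k_leaf_connected\<close> without the bound on the order, phrased for
parent functions and for a bare arc relation on a vertex set, so that edges can be added to or
removed from the relation.
\<close>
definition leaf_connected :: "nat \<Rightarrow> 'a set \<Rightarrow> ('a \<times> 'a) set \<Rightarrow> bool" where
  "leaf_connected k V E \<longleftrightarrow> (\<forall>S. S \<subseteq> V \<and> card S = k \<longrightarrow> has_tree E V S)"

lemma leaf_connected_imp_k_leaf_connected:
  assumes "pair_graph G" "k + 1 \<le> card (pverts G)" "leaf_connected k (pverts G) (parcs G)"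
  shows "k_leaf_connected k G"
  using assms has_tree_imp_spanning_tree[OF assms(1)]
  by (auto simp: k_leaf_connected_def leaf_connected_def)

section \<open>Degree sums of nonadjacent vertices and the Zagreb index\<close>

text \<open>
The arcs of $K_{|X|} \vee (K_{|M|} + |P| K_1)$ on given vertex classes.
\<close>
definition split_arcs :: "'a set \<Rightarrow> 'a set \<Rightarrow> 'a set \<Rightarrow> ('a \<times> 'a) set" where
  "split_arcs X M P = {(x, y). x \<in> X \<union> M \<union> P \<and> y \<in> X \<union> M \<union> P \<and> x \<noteq> y \<and>
     (x \<in> X \<or> y \<in> X \<or> (x \<in> M \<and> y \<in> M))}"

text \<open>
The first Zagreb index of $K_a \vee (K_q + p K_1)$, as a polynomial in integers so that
subtraction is not truncated.
\<close>
definition zagreb_split :: "int \<Rightarrow> int \<Rightarrow> int \<Rightarrow> int" where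
  "zagreb_split a q p = a * (a + q + p - 1)\<^sup>2 + q * (a + q - 1)\<^sup>2 + p * a\<^sup>2"

definition zagreb_bound :: "int \<Rightarrow> int \<Rightarrow> int" where
  "zagreb_bound n k = n ^ 3 - 8 * n ^ 2 + (4 * k + 25) * n + 2 * k ^ 2 - 4 * k - 24"

lemma sum_three_bound:
  fixes f :: "'a \<Rightarrow> int"
  assumes "finite V" "A \<subseteq> V" "B \<subseteq> V" "A \<inter> B = {}"
    and "\<And>x. x \<in> A \<Longrightarrow> f x \<le> \<alpha>" "\<And>x. x \<in> B \<Longrightarrow> f x \<le> \<beta>" "\<And>x. x \<in> V \<Longrightarrow> f x \<le> \<gamma>"
  shows "sum f V \<le> int (card A) * \<alpha> + int (card B) * \<beta>
    + (int (card V) - int (card A) - int (card B)) * \<gamma>"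
proof -
  let ?C = "V - A - B"
  have fin: "finite A" "finite B" "finite ?C" using assms(1-3) by (auto intro: finite_subset)
  have V: "V = (A \<union> B) \<union> ?C" using assms(2,3) by auto
  have "sum f V = sum f (A \<union> B) + sum f ?C"
    by (subst V, rule sum.union_disjoint) (use fin in auto)
  also have "sum f (A \<union> B) = sum f A + sum f B"
    using fin assms(4) by (rule_tac sum.union_disjoint) auto
  finally have "sum f V = sum f A + sum f B + sum f ?C" .
  moreover have "card V = card A + card B + card ?C"
  proof -
    have "card V = card (A \<union> B) + card ?C"
      by (subst V, rule card_Un_disjoint) (use fin in auto)
    then show ?thesis using fin assms(4) by (simp add: card_Un_disjoint)
  qed
  moreover have "sum f A \<le> int (card A) * \<alpha>"
    using sum_bounded_above[of A f \<alpha>] assms(5) by simp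
  moreover have "sum f B \<le> int (card B) * \<beta>"
    using sum_bounded_above[of B f \<beta>] assms(6) by simp
  moreover have "sum f ?C \<le> int (card ?C) * \<gamma>"
    using sum_bounded_above[of ?C f \<gamma>] assms(7) by simp
  ultimately show ?thesis by simp
qed

text \<open>
Here $K = k + 1$ is the least possible degree, $a = K + t$, and $n = K + 3 + 2t + s$. The pair
$(t, s) = (0, n - k - 4)$ gives the graph whose index is the bound, hence the factor $t$.
\<close>
lemma zagreb_gap:
  "zagreb_bound (K + 3 + 2 * t + s) (K - 1) - zagreb_split (K + t) (s + 1) (t + 2)
     = t * (2 * K * (t + 2 * s - 3) + 3 * t\<^sup>2 + 7 * t * s + 3 * s\<^sup>2 - 7 * t - 2 * s - 4)"
  unfolding zagreb_bound_def zagreb_split_def by algebra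

text \<open>
Moving a vertex from the independent part into the clique adds edges, so the index grows.
\<close>
lemma zagreb_split_mono:
  assumes "0 \<le> a" "1 \<le> q" "q \<le> q'"
  shows "zagreb_split a q (r - q) \<le> zagreb_split a q' (r - q')"
proof -
  have sq: "(a + q - 1)\<^sup>2 \<le> (a + q' - 1)\<^sup>2" "a\<^sup>2 \<le> (a + q' - 1)\<^sup>2"
    using assms by (auto intro: power_mono)
  have "q * (a + q - 1)\<^sup>2 \<le> q * (a + q' - 1)\<^sup>2"
    using sq(1) assms by (intro mult_left_mono) auto
  moreover have "(q' - q) * a\<^sup>2 \<le> (q' - q) * (a + q' - 1)\<^sup>2"
    using sq(2) assms by (intro mult_left_mono) auto
  moreover have "a + q + (r - q) - 1 = a + r - 1" "a + q' + (r - q') - 1 = a + r - 1" by simp_all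
  ultimately show ?thesis
    unfolding zagreb_split_def by (simp add: algebra_simps)
qed

lemma zagreb_split_strict_mono:
  assumes "0 \<le> a" "1 \<le> q"
  shows "zagreb_split a q (r - q) < zagreb_split a (q + 1) (r - (q + 1))"
proof -
  have "q * (a + q - 1)\<^sup>2 \<le> q * (a + q)\<^sup>2"
    using assms by (intro mult_left_mono power_mono) auto
  moreover have "a\<^sup>2 < (a + q)\<^sup>2"
    using assms by (intro power_strict_mono) auto
  moreover have "a + q + (r - q) - 1 = a + r - 1" "a + (q + 1) + (r - (q + 1)) - 1 = a + r - 1"
    by simp_all
  ultimately show ?thesis
    unfolding zagreb_split_def by (simp add: algebra_simps)
qed

text \<open>
The remaining pairs are exactly the four shapes: $t = 0$ is the family with two isolated vertices,
and $(1,0)$, $(1,1)$, $(2,0)$ are $K_{k+2} \vee 4K_1$, $K_{k+2} \vee (K_2 + 3K_1)$ and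
$K_{k+3} \vee 5K_1$.
\<close>
lemma zagreb_gap_cases:
  fixes K t s :: int
  assumes "3 \<le> K" "0 \<le> t" "0 \<le> s"
    and "zagreb_bound (K + 3 + 2 * t + s) (K - 1) \<le> zagreb_split (K + t) (s + 1) (t + 2)"
  shows "t = 0 \<or> (t = 1 \<and> s \<le> 1) \<or> (t = 2 \<and> s = 0)"
proof -
  let ?g = "2 * K * (t + 2 * s - 3) + 3 * t\<^sup>2 + 7 * t * s + 3 * s\<^sup>2 - 7 * t - 2 * s - 4"
  have le: "t * ?g \<le> 0" using assms(4) zagreb_gap[of K t s] by linarith
  consider "t = 0" | "t = 1" | "t = 2" | "3 \<le> t" using assms(2) by linarith
  then show ?thesis
  proof cases
    case 2
    then have "(s - 1) * (4 * K + 3 * s + 8) \<le> 0"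
      using le by (simp add: algebra_simps power2_eq_square)
    then have "s \<le> 1" using assms by (smt (verit) mult_pos_pos)
    with 2 show ?thesis by simp
  next
    case 3
    then have "2 * K * (2 * s - 1) + 3 * s\<^sup>2 + 12 * s - 6 \<le> 0"
      using le by (simp add: algebra_simps)
    moreover have "0 < 2 * K * (2 * s - 1) + 3 * s\<^sup>2 + 12 * s - 6" if "1 \<le> s"
    proof -
      have "0 \<le> 2 * K * (2 * s - 1)" using that assms by simp
      moreover have "0 \<le> 3 * s\<^sup>2" by simp
      ultimately show ?thesis using that by linarith
    qed
    ultimately have "s = 0" using assms by linarith
    with 3 show ?thesis by simp
  next
    case 4
    have "0 \<le> 2 * K * (t + 2 * s - 3)" using 4 assms by simp
    moreover have "3 * t * 3 \<le> 3 * t\<^sup>2" using 4 by (simp add: power2_eq_square)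
    moreover have "7 * 3 * s \<le> 7 * t * s" using 4 assms by (intro mult_right_mono) auto
    moreover have "0 \<le> 3 * s\<^sup>2" by simp
    ultimately have "0 < ?g" using 4 assms by linarith
    then have "0 < t * ?g" using 4 by simp
    then show ?thesis using le by linarith
  qed simp
qed

text \<open>
The number $4n - 8 = (n-1)^2 - (n-3)^2$ is what the index loses when the degree of one dominating
vertex drops to $n - 3$. It exceeds the surplus $4K + 8$ or $4K + 12$ that the pairs $(1,0)$
and $(2,0)$ have over the bound.
\<close>
lemma zagreb_gap_large:
  fixes K t s :: int
  assumes "3 \<le> K" "0 \<le> t" "0 \<le> s"
  shows "zagreb_split (K + t) (s + 1) (t + 2) - (4 * (K + 3 + 2 * t + s) - 8)
    < zagreb_bound (K + 3 + 2 * t + s) (K - 1)"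
proof (rule ccontr)
  assume neg: "\<not> ?thesis"
  have "8 \<le> 4 * (K + 3 + 2 * t + s)" using assms by simp
  then have "t = 0 \<or> (t = 1 \<and> s \<le> 1) \<or> (t = 2 \<and> s = 0)"
    using zagreb_gap_cases[OF assms] neg by linarith
  moreover have "s = 0 \<or> s = 1" if "s \<le> 1" using that assms by auto
  ultimately have "t = 0 \<or> (t = 1 \<and> s = 0) \<or> (t = 1 \<and> s = 1) \<or> (t = 2 \<and> s = 0)" by auto
  then show False
    using zagreb_gap[of K t s] neg assms by auto
qed

text \<open>
Let $X$ be the neighbourhood of the vertex $u$ of smaller degree in a nonadjacent pair with largest
degree sum. A vertex that is not dominating has degree at most $n - 3$ by the two degree
conditions, so by \<open>zagreb_gap_large\<close> all vertices of $X$ are dominating. The vertices not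
adjacent to $v$ have degree at most $|X|$ and hence no neighbours outside $X$. What is left is $M$,
which contains $v$. It is a single vertex, or the bound is attained with equality and makes $M$ a
clique.
\<close>
lemma split_structure:
  fixes E :: "('a \<times> 'a) set" and n k :: nat
  defines "D \<equiv> \<lambda>x. card (E `` {x})"
  assumes V: "finite V" "card V = n" and E: "E \<subseteq> V \<times> V" "sym E" "irrefl E"
    and k: "2 \<le> k"
    and nonadj: "\<And>x y. x \<in> V \<Longrightarrow> y \<in> V \<Longrightarrow> x \<noteq> y \<Longrightarrow> (x, y) \<notin> E \<Longrightarrow> D x + D y + 2 \<le> n + k"
    and mindeg: "\<And>x. x \<in> V \<Longrightarrow> k + 1 \<le> D x"
    and noncomplete: "\<exists>x\<in>V. \<exists>y\<in>V. x \<noteq> y \<and> (x, y) \<notin> E"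
    and M1: "zagreb_bound (int n) (int k) \<le> int (\<Sum>x\<in>V. (D x)\<^sup>2)"
  obtains X M P where "V = X \<union> M \<union> P" "X \<inter> M = {}" "X \<inter> P = {}" "M \<inter> P = {}"
    "E = split_arcs X M P"
    "(card X = k + 1 \<and> card P = 2) \<or> (card X = k + 2 \<and> card P = 3 \<and> card M \<in> {1, 2}) \<or>
     (card X = k + 3 \<and> card P = 4 \<and> card M = 1)"
proof -
  have nbV: "E `` {x} \<subseteq> V" "x \<notin> E `` {x}" for x
    using E by (auto simp: irrefl_def)
  have finN: "finite (E `` {x})" for x using nbV(1) V(1) by (rule finite_subset)
  have symE: "(x, y) \<in> E \<longleftrightarrow> (y, x) \<in> E" for x y using E(2) by (auto dest: symD)
  define NA where "NA = {(x, y). x \<in> V \<and> y \<in> V \<and> x \<noteq> y \<and> (x, y) \<notin> E \<and> D x \<le> D y}"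
  have "finite NA" by (rule finite_subset[of _ "V \<times> V"]) (use V in \<open>auto simp: NA_def\<close>)
  moreover have "NA \<noteq> {}"
  proof -
    obtain x y where "x \<in> V" "y \<in> V" "x \<noteq> y" "(x, y) \<notin> E" using noncomplete by blast
    then have "(x, y) \<in> NA \<or> (y, x) \<in> NA" using symE[of x y] by (auto simp: NA_def)
    then show ?thesis by blast
  qed
  ultimately obtain u v where uv: "(u, v) \<in> NA"
    and max': "\<And>x y. (x, y) \<in> NA \<Longrightarrow> D x + D y \<le> D u + D v"
    using Max_in[of "(\<lambda>(x, y). D x + D y) ` NA"] Max_ge[of "(\<lambda>(x, y). D x + D y) ` NA"]
    by (smt (verit, best) case_prod_conv empty_is_image finite_imageI imageE imageI surj_pair)
  have max: "D x + D y \<le> D u + D v" if "x \<in> V" "y \<in> V" "x \<noteq> y" "(x, y) \<notin> E" for x y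
    using max'[of x y] max'[of y x] that symE by (force simp: NA_def)
  have uv': "u \<in> V" "v \<in> V" "u \<noteq> v" "(u, v) \<notin> E" "(v, u) \<notin> E" "D u \<le> D v"
    using uv symE by (auto simp: NA_def)
  define a where "a = D u"
  define b where "b = D v"
  define X where "X = E `` {u}"
  define P where "P = V - E `` {v} - {v}"
  define Q where "Q = V - X"
  have ab: "a \<le> b" "a + b + 2 \<le> n + k" "k + 1 \<le> a"
    using uv' nonadj mindeg by (auto simp: a_def b_def)
  have fin: "finite X" "finite P" "finite Q"
    using V finN by (auto simp: X_def P_def Q_def)
  have cardX: "card X = a" by (simp add: X_def a_def D_def)
  have XV: "X \<subseteq> V" using nbV by (simp add: X_def)
  have "card Q = n - a" "a \<le> n"
    using XV fin V card_mono[OF V(1) XV] by (auto simp: Q_def card_Diff_subset cardX)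
  then have cardQ: "card Q + a = n" by simp
  have "P = V - insert v (E `` {v})" "insert v (E `` {v}) \<subseteq> V"
    using nbV uv' by (auto simp: P_def)
  then have "card P = n - (b + 1)" "b + 1 \<le> n"
    using V finN[of v] nbV(2)[of v] card_mono[OF V(1), of "insert v (E `` {v})"]
    by (auto simp: card_Diff_subset b_def D_def)
  then have cardP: "card P + b + 1 = n" by simp
  have P_le: "D x \<le> a" if "x \<in> P" for x
    using max[of x v] that uv' symE by (force simp: P_def a_def)
  have Q_le: "D x \<le> b" if "x \<in> Q" for x
    using max[of x u] that uv' ab symE by (cases "x = u") (force simp: Q_def X_def a_def b_def)+
  have all_le: "D x + 1 \<le> n" if "x \<in> V" for x
    using card_mono[OF V(1), of "insert x (E `` {x})"] that nbV[of x] finN[of x] V(2)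
    by (auto simp: D_def)
  have nondom_le: "D x + 3 \<le> n" if "x \<in> V" "y \<in> V" "x \<noteq> y" "(x, y) \<notin> E" for x y
    using nonadj[OF that] mindeg[OF that(2)] by linarith
  have bn: "b + 3 \<le> n" using nondom_le[of v u] uv' by (simp add: b_def)
  have uP: "u \<in> P" "u \<in> Q" "v \<in> Q" "v \<notin> P"
    using uv' nbV(2)[of u] by (auto simp: P_def Q_def X_def)
  define N where "N = int n"
  define A where "A = int a"
  define B where "B = int b"
  define K where "K = int k + 1"
  define t where "t = A - K"
  \<comment> \<open>Both parameters are nonnegative: \<open>a \<ge> k + 1\<close> and \<open>2 * a \<le> a + b \<le> n + k - 2\<close>.\<close>
  define s where "s = N - K - 3 - 2 * t"
  have par: "A = K + t" "N = K + 3 + 2 * t + s" "int k = K - 1" "3 \<le> K" "0 \<le> t" "0 \<le> s"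
    "A \<le> B" "A + B + 2 \<le> N + K - 1" "B + 3 \<le> N"
    using ab k bn by (simp_all add: t_def s_def A_def B_def N_def K_def)
  let ?f = "\<lambda>x. (int (D x))\<^sup>2"
  have M1': "zagreb_bound N (K - 1) \<le> sum ?f V"
    using M1 by (simp add: N_def K_def)
  have cP: "int (card P) = N - B - 1" and cQ: "int (card Q) = N - A" and cV: "int (card V) = N"
    using cardP cardQ V by (simp_all add: N_def A_def B_def)
  have fP: "?f x \<le> A\<^sup>2" if "x \<in> P" for x using P_le[OF that] by (simp add: A_def power_mono)
  have fQ: "?f x \<le> B\<^sup>2" if "x \<in> Q" for x using Q_le[OF that] by (simp add: B_def power_mono)
  have fV: "?f x \<le> (N - 1)\<^sup>2" if "x \<in> V" for x
    using all_le[OF that] by (intro power_mono) (auto simp: N_def)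
  have N3: "(N - 1)\<^sup>2 - (N - 3)\<^sup>2 = 4 * N - 8" by (simp add: power2_eq_square algebra_simps)
  \<comment> \<open>The bound grows with \<open>B\<close>, and \<open>B \<le> N + K - 3 - A\<close>.\<close>
  have B_q: "B + 1 - A \<le> s + 1" "1 \<le> B + 1 - A" using par by linarith+
  have "zagreb_split A (B + 1 - A) (N - A - (B + 1 - A)) \<le> zagreb_split A (s + 1) (N - A - (s + 1))"
    by (rule zagreb_split_mono) (use B_q in \<open>simp_all add: A_def\<close>)
  moreover have "N - A - (B + 1 - A) = N - B - 1" "N - A - (s + 1) = t + 2" using par by simp_all
  ultimately have F_le: "zagreb_split A (B + 1 - A) (N - B - 1) \<le> zagreb_split (K + t) (s + 1) (t + 2)"
    by (simp only: par(1)[symmetric])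
  have F_eq: "zagreb_split A (B + 1 - A) (N - B - 1)
      = A * (N - 1)\<^sup>2 + (B + 1 - A) * B\<^sup>2 + (N - B - 1) * A\<^sup>2"
    by (simp add: zagreb_split_def)
  have X_dom: "(x, y) \<in> E" if x: "x \<in> X" and y: "y \<in> V" "y \<noteq> x" for x y
  proof (rule ccontr)
    assume nxy: "(x, y) \<notin> E"
    have xV: "x \<in> V" using x XV by auto
    have "sum ?f V \<le> zagreb_split A (B + 1 - A) (N - B - 1) - (4 * N - 8)"
    proof (cases "P \<subseteq> Q")
      \<comment> \<open>Then \<open>x\<close> is counted with \<open>(N - 1)\<^sup>2\<close> in the bound but has degree at most \<open>N - 3\<close>.\<close>
      case True
      have "x \<notin> Q" using x by (simp add: Q_def)
      have fx: "?f x \<le> (N - 3)\<^sup>2"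
        using nondom_le[OF xV y(1) y(2)[symmetric] nxy] by (intro power_mono) (auto simp: N_def)
      have "sum ?f (V - {x}) \<le> int (card P) * A\<^sup>2 + int (card (Q - P)) * B\<^sup>2
          + (int (card (V - {x})) - int (card P) - int (card (Q - P))) * (N - 1)\<^sup>2"
        by (rule sum_three_bound)
          (use V fP fQ fV True \<open>x \<notin> Q\<close> in \<open>auto simp: Q_def\<close>)
      moreover have "int (card (Q - P)) = B + 1 - A"
        using card_Diff_subset[OF fin(2) True] card_mono[OF fin(3) True] cP cQ by auto
      moreover have "int (card (V - {x})) = N - 1"
        using V xV cV card_Suc_Diff1[OF V(1) xV] by linarith
      moreover have "sum ?f V = ?f x + sum ?f (V - {x})"
        using V(1) xV by (rule sum.remove)
      ultimately have "sum ?f V \<le> (N - 3)\<^sup>2 + (N - B - 1) * A\<^sup>2 + (B + 1 - A) * B\<^sup>2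
          + (A - 1) * (N - 1)\<^sup>2"
        using fx cP by simp
      then show ?thesis
        unfolding F_eq using N3 by (simp add: algebra_simps)
    next
      case False
      \<comment> \<open>Then \<open>P \<union> Q\<close> has a further element, whose square is at most \<open>B\<^sup>2 \<le> (N - 3)\<^sup>2\<close>
        instead of \<open>(N - 1)\<^sup>2\<close>.\<close>
      then obtain z where z: "z \<in> P" "z \<notin> Q" by auto
      have "sum ?f V \<le> int (card P) * A\<^sup>2 + int (card (Q - P)) * B\<^sup>2
          + (int (card V) - int (card P) - int (card (Q - P))) * (N - 1)\<^sup>2"
        by (rule sum_three_bound)
          (use V fP fQ fV in \<open>auto simp: Q_def P_def\<close>)
      then have le: "sum ?f V \<le> (N - B - 1) * A\<^sup>2 + int (card (Q - P)) * B\<^sup>2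
          + (B + 1 - int (card (Q - P))) * (N - 1)\<^sup>2"
        unfolding cP cV by (simp add: algebra_simps)
      have "card (insert z Q) \<le> card (P \<union> (Q - P))"
        using fin z by (intro card_mono) auto
      also have "\<dots> \<le> card P + card (Q - P)" by (rule card_Un_le)
      finally have q: "B + 2 - A \<le> int (card (Q - P))"
        using fin z cP cQ by simp
      have "B\<^sup>2 \<le> (N - 3)\<^sup>2" using par by (intro power_mono) (auto simp: B_def)
      then have "4 * N - 8 \<le> (N - 1)\<^sup>2 - B\<^sup>2" using N3 by linarith
      moreover have "0 \<le> 4 * N - 8" using par by linarith
      ultimately have "1 * (4 * N - 8) \<le> (int (card (Q - P)) - (B + 1 - A)) * ((N - 1)\<^sup>2 - B\<^sup>2)"
        using q by (intro mult_mono) auto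
      then show ?thesis
        unfolding F_eq using le by (simp add: algebra_simps)
    qed
    then show False
      using M1' F_le zagreb_gap_large[OF par(4-6)] unfolding par(2) by linarith
  qed
  define M where "M = Q - P"
  have PQ: "P \<subseteq> Q"
    using X_dom uv' symE by (fastforce simp: P_def Q_def X_def)
  have vM: "v \<in> M" using uP by (simp add: M_def)
  have V_eq: "V = X \<union> M \<union> P" "X \<inter> M = {}" "X \<inter> P = {}" "M \<inter> P = {}"
    using PQ XV by (auto simp: M_def Q_def)
  have cardM: "int (card M) = B + 1 - A"
    using card_Diff_subset[OF fin(2) PQ] card_mono[OF fin(3) PQ] cP cQ by (auto simp: M_def)
  have NP: "E `` {x} = X" if x: "x \<in> P" for x
  proof -
    have "X \<subseteq> E `` {x}"
    proof
      fix y assume y: "y \<in> X"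
      have "(y, x) \<in> E" using X_dom[OF y, of x] x y V_eq(1,3) by blast
      then show "y \<in> E `` {x}" using symE by blast
    qed
    moreover have "card (E `` {x}) \<le> card X"
      using P_le[OF x] by (simp add: D_def cardX)
    ultimately show ?thesis using card_seteq[OF finN] by metis
  qed
  have NM: "E `` {x} \<subseteq> X \<union> M - {x}" if x: "x \<in> M" for x
  proof
    fix y assume y: "y \<in> E `` {x}"
    have "y \<notin> P"
    proof
      assume "y \<in> P"
      moreover have "x \<in> E `` {y}" using y symE by blast
      ultimately show False using NP[of y] x V_eq(2) by blast
    qed
    then show "y \<in> X \<union> M - {x}" using y nbV[of x] V_eq by auto
  qed
  have finM: "finite M" using fin by (simp add: M_def)
  have cXM: "int (card (X \<union> M - {x})) = B" if "x \<in> M" for x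
    using that fin finM V_eq(2) cardM cardX card_Suc_Diff1[of "X \<union> M" x]
    by (simp add: card_Un_disjoint A_def)
  have fM: "?f x \<le> B\<^sup>2" if "x \<in> M" for x using fQ that by (simp add: M_def)
  have sumV: "sum ?f V = sum ?f X + sum ?f P + sum ?f M"
  proof -
    have "sum ?f V = sum ?f (X \<union> M) + sum ?f P"
      unfolding V_eq(1) by (rule sum.union_disjoint) (use fin finM V_eq in auto)
    also have "sum ?f (X \<union> M) = sum ?f X + sum ?f M"
      by (rule sum.union_disjoint) (use fin finM V_eq in auto)
    finally show ?thesis by simp
  qed
  have sX: "sum ?f X \<le> A * (N - 1)\<^sup>2"
    using sum_bounded_above[of X ?f "(N - 1)\<^sup>2"] fV XV cardX by (auto simp: A_def)
  have sP: "sum ?f P \<le> (N - B - 1) * A\<^sup>2"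
    using sum_bounded_above[of P ?f "A\<^sup>2"] fP cP by auto
  have sM: "sum ?f M \<le> (B + 1 - A) * B\<^sup>2"
    using sum_bounded_above[of M ?f "B\<^sup>2"] fM cardM by auto
  have le1: "sum ?f V \<le> zagreb_split A (B + 1 - A) (N - B - 1)"
    unfolding F_eq using sumV sX sP sM by linarith
  then have bound: "zagreb_bound N (K - 1) \<le> zagreb_split (K + t) (s + 1) (t + 2)"
    using M1' F_le by linarith
  have cases: "t = 0 \<or> (t = 1 \<and> s \<le> 1) \<or> (t = 2 \<and> s = 0)"
    using zagreb_gap_cases[OF par(4-6)] bound unfolding par(2) by blast
  \<comment> \<open>Unless \<open>M\<close> is a single vertex, the bound is attained, so \<open>M\<close> is a clique of full size.\<close>
  have tight: "B + 1 - A = s + 1 \<and> (\<forall>x\<in>M. E `` {x} = X \<union> M - {x})"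
  proof (cases "s = 0")
    case True
    then have "B + 1 - A = 1" using B_q by linarith
    then have "card M = 1" using cardM by linarith
    then have M: "M = {v}" using vM by (metis card_1_singletonE singletonD)
    have "X \<subseteq> E `` {v}"
    proof
      fix y assume y: "y \<in> X"
      have "(y, v) \<in> E" using X_dom[OF y, of v] y vM V_eq(1,2) by blast
      then show "y \<in> E `` {v}" using symE by blast
    qed
    then have "E `` {v} = X \<union> M - {v}"
      using NM[OF vM] M V_eq by auto
    then show ?thesis using M True \<open>B + 1 - A = 1\<close> by simp
  next
    case False
    then have "t = 0 \<or> (t = 1 \<and> s = 1)" using cases par by linarith
    then have eq: "zagreb_bound N (K - 1) = zagreb_split (K + t) (s + 1) (t + 2)"
      using zagreb_gap[of K t s] unfolding par(2) by auto
    have q: "B + 1 - A = s + 1"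
    proof (rule ccontr)
      assume "B + 1 - A \<noteq> s + 1"
      then have "B + 1 - A \<le> s" using B_q by linarith
      have "zagreb_split A (B + 1 - A) (N - A - (B + 1 - A)) \<le> zagreb_split A s (N - A - s)"
        by (rule zagreb_split_mono) (use B_q \<open>B + 1 - A \<le> s\<close> in \<open>simp_all add: A_def\<close>)
      moreover have "zagreb_split A s (N - A - s) < zagreb_split A (s + 1) (N - A - (s + 1))"
        by (rule zagreb_split_strict_mono) (use False par in \<open>simp_all add: A_def\<close>)
      moreover have "N - A - (B + 1 - A) = N - B - 1" "N - A - (s + 1) = t + 2" using par by simp_all
      ultimately have "zagreb_split A (B + 1 - A) (N - B - 1) < zagreb_split (K + t) (s + 1) (t + 2)"
        by (simp only: par(1)[symmetric])
      then show False using le1 M1' eq by linarith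
    qed
    have "E `` {x} = X \<union> M - {x}" if x: "x \<in> M" for x
    proof (rule ccontr)
      assume "E `` {x} \<noteq> X \<union> M - {x}"
      then have "card (E `` {x}) < card (X \<union> M - {x})"
        using NM[OF x] fin finM by (intro psubset_card_mono) auto
      then have "int (D x) < B" using cXM[OF x] by (simp add: D_def)
      then have "?f x < B\<^sup>2" by (intro power_strict_mono) auto
      then have "sum ?f M < (\<Sum>x\<in>M. B\<^sup>2)"
        using finM fM x by (intro sum_strict_mono_ex1) auto
      then have "sum ?f M < (B + 1 - A) * B\<^sup>2" using cardM by simp
      then have "sum ?f V < zagreb_split A (B + 1 - A) (N - B - 1)"
        unfolding F_eq using sumV sX sP by linarith
      then show False using M1' eq F_le by linarith
    qed
    with q show ?thesis by simp
  qed
  have "(x, y) \<in> E \<longleftrightarrow> (x, y) \<in> split_arcs X M P" for x y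
  proof -
    consider "x \<notin> V" | "x \<in> X" | "x \<in> M" | "x \<in> P" using V_eq(1) by blast
    then show ?thesis
    proof cases
      case 1
      then show ?thesis using E(1) V_eq by (auto simp: split_arcs_def)
    next
      case 2
      then show ?thesis
        using X_dom[OF 2, of y] nbV[of x] V_eq(1) E(1) by (auto simp: split_arcs_def)
    next
      case 3
      then have "(x, y) \<in> E \<longleftrightarrow> y \<in> X \<union> M - {x}" using tight by auto
      then show ?thesis using 3 V_eq by (auto simp: split_arcs_def)
    next
      case 4
      then have "(x, y) \<in> E \<longleftrightarrow> y \<in> X" using NP[OF 4] by auto
      then show ?thesis using 4 V_eq by (auto simp: split_arcs_def)
    qed
  qed
  then have E_eq: "E = split_arcs X M P" by auto
  have cards: "int (card X) = int k + 1 + t" "int (card M) = s + 1" "int (card P) = t + 2"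
    using tight cardM cP cardX par by (auto simp: A_def)
  have "(card X = k + 1 \<and> card P = 2) \<or> (card X = k + 2 \<and> card P = 3 \<and> card M \<in> {1, 2}) \<or>
     (card X = k + 3 \<and> card P = 4 \<and> card M = 1)"
    using cases cards par by auto
  with that[OF V_eq E_eq] show thesis by blast
qed

section \<open>Recognising joins and disjoint unions\<close>

text \<open>
An isomorphism from the subgraph of $E$ induced by $V$ onto $H$. Stating it for vertex sets of an
ambient relation lets the parts of a join or a union be treated one after the other.
\<close>
definition matches :: "'a set \<Rightarrow> ('a \<times> 'a) set \<Rightarrow> 'b pair_pre_digraph \<Rightarrow> bool" where
  "matches V E H \<longleftrightarrow> parcs H \<subseteq> pverts H \<times> pverts H \<and>
     (\<exists>f. bij_betw f V (pverts H) \<and> (\<forall>x\<in>V. \<forall>y\<in>V. (x, y) \<in> E \<longleftrightarrow> (f x, f y) \<in> parcs H))"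

lemma matches_imp_graph_iso:
  assumes "pair_graph G" "matches (pverts G) (parcs G) H"
  shows "graph_iso G H"
proof -
  obtain f where f: "bij_betw f (pverts G) (pverts H)"
    "\<And>x y. x \<in> pverts G \<Longrightarrow> y \<in> pverts G \<Longrightarrow> (x, y) \<in> parcs G \<longleftrightarrow> (f x, f y) \<in> parcs H"
    and H: "parcs H \<subseteq> pverts H \<times> pverts H"
    using assms(2) by (auto simp: matches_def)
  have G: "parcs G \<subseteq> pverts G \<times> pverts G" using assms(1) by (simp add: pair_graph_iff)
  have fim: "f ` pverts G = pverts H" using f(1) by (simp add: bij_betw_def)
  have "parcs H = map_prod f f ` parcs G"
  proof (intro set_eqI iffI)
    fix e assume e: "e \<in> parcs H"
    then obtain x y where "e = (f x, f y)" "x \<in> pverts G" "y \<in> pverts G"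
      using H fim by (cases e) blast
    then show "e \<in> map_prod f f ` parcs G" using e f(2) by force
  next
    fix e assume "e \<in> map_prod f f ` parcs G"
    then show "e \<in> parcs H" using f(2) G by auto
  qed
  then show ?thesis
    using f(1) fim unfolding graph_iso_iff[OF assms(1)] bij_betw_def by metis
qed

lemma matches_Plus:
  assumes "pverts H = pverts H1 <+> pverts H2" "parcs H \<subseteq> pverts H \<times> pverts H"
    and "matches X E H1" "matches Y E H2" "X \<inter> Y = {}"
    and "\<And>u v. (Inl u, Inl v) \<in> parcs H \<longleftrightarrow> (u, v) \<in> parcs H1"
      "\<And>u v. (Inr u, Inr v) \<in> parcs H \<longleftrightarrow> (u, v) \<in> parcs H2"
    and "\<And>x y u v. x \<in> X \<Longrightarrow> y \<in> Y \<Longrightarrow> u \<in> pverts H1 \<Longrightarrow> v \<in> pverts H2 \<Longrightarrow>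
      ((x, y) \<in> E \<longleftrightarrow> (Inl u, Inr v) \<in> parcs H) \<and> ((y, x) \<in> E \<longleftrightarrow> (Inr v, Inl u) \<in> parcs H)"
  shows "matches (X \<union> Y) E H"
proof -
  obtain f where f: "bij_betw f X (pverts H1)"
    "\<And>x y. x \<in> X \<Longrightarrow> y \<in> X \<Longrightarrow> (x, y) \<in> E \<longleftrightarrow> (f x, f y) \<in> parcs H1"
    using assms(3) by (auto simp: matches_def)
  obtain g where g: "bij_betw g Y (pverts H2)"
    "\<And>x y. x \<in> Y \<Longrightarrow> y \<in> Y \<Longrightarrow> (x, y) \<in> E \<longleftrightarrow> (g x, g y) \<in> parcs H2"
    using assms(4) by (auto simp: matches_def)
  define h where "h z = (if z \<in> X then Inl (f z) else Inr (g z))" for z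
  have hX: "h x = Inl (f x)" "f x \<in> pverts H1" if "x \<in> X" for x
    using that f(1) by (auto simp: h_def bij_betw_def)
  have hY: "h y = Inr (g y)" "g y \<in> pverts H2" if "y \<in> Y" for y
    using that g(1) assms(5) by (auto simp: h_def bij_betw_def)
  have "bij_betw h X (Inl ` pverts H1)"
    using f(1) hX(1) by (auto simp: bij_betw_def inj_on_def image_iff)
  moreover have "bij_betw h Y (Inr ` pverts H2)"
    using g(1) hY(1) by (auto simp: bij_betw_def inj_on_def image_iff)
  ultimately have "bij_betw h (X \<union> Y) (Inl ` pverts H1 \<union> Inr ` pverts H2)"
    by (rule bij_betw_combine) auto
  then have "bij_betw h (X \<union> Y) (pverts H)"
    unfolding assms(1) by (simp add: Plus_def)
  moreover have "(x, y) \<in> E \<longleftrightarrow> (h x, h y) \<in> parcs H" if "x \<in> X \<union> Y" "y \<in> X \<union> Y" for x y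
    using that f(2)[of x y] g(2)[of x y] hX[of x] hX[of y] hY[of x] hY[of y]
      assms(6,7) assms(8)[of x y "f x" "g y"] assms(8)[of y x "f y" "g x"]
    by (elim UnE) simp_all
  ultimately show ?thesis
    using assms(2) unfolding matches_def by blast
qed

lemma matches_graph_union:
  assumes "matches X E H1" "matches Y E H2" "X \<inter> Y = {}"
    and "\<And>x y. x \<in> X \<Longrightarrow> y \<in> Y \<Longrightarrow> (x, y) \<notin> E \<and> (y, x) \<notin> E"
  shows "matches (X \<union> Y) E (graph_union H1 H2)"
proof (rule matches_Plus[OF _ _ assms(1-3)])
  show "parcs (graph_union H1 H2) \<subseteq> pverts (graph_union H1 H2) \<times> pverts (graph_union H1 H2)"
    using assms(1,2) by (auto simp: graph_union_def matches_def)
qed (use assms(4) in \<open>auto simp: graph_union_def\<close>)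

lemma matches_graph_join:
  assumes "matches X E H1" "matches Y E H2" "X \<inter> Y = {}"
    and "\<And>x y. x \<in> X \<Longrightarrow> y \<in> Y \<Longrightarrow> (x, y) \<in> E \<and> (y, x) \<in> E"
  shows "matches (X \<union> Y) E (graph_join H1 H2)"
proof (rule matches_Plus[OF _ _ assms(1-3)])
  show "parcs (graph_join H1 H2) \<subseteq> pverts (graph_join H1 H2) \<times> pverts (graph_join H1 H2)"
    using assms(1,2) by (auto simp: graph_join_def graph_union_def matches_def)
qed (use assms(4) in \<open>auto simp: graph_join_def graph_union_def\<close>)

lemma matches_complete_graph:
  assumes "finite X" "card X = m" "\<And>x y. x \<in> X \<Longrightarrow> y \<in> X \<Longrightarrow> (x, y) \<in> E \<longleftrightarrow> x \<noteq> y"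
  shows "matches X E (complete_graph m)"
proof -
  obtain f where f: "bij_betw f X {..<m}"
    using ex_bij_betw_finite_nat[OF assms(1)] assms(2) by (auto simp: atLeast0LessThan)
  have "(x, y) \<in> E \<longleftrightarrow> (f x, f y) \<in> parcs (complete_graph m)" if "x \<in> X" "y \<in> X" for x y
    using that f assms(3)[OF that] by (auto simp: complete_graph_def bij_betw_def inj_on_def)
  then show ?thesis
    using f unfolding matches_def by (auto simp: complete_graph_def)
qed

lemma matches_graph_copies_K1:
  assumes "finite X" "card X = t" "\<And>x y. x \<in> X \<Longrightarrow> y \<in> X \<Longrightarrow> (x, y) \<notin> E"
  shows "matches X E (graph_copies t (complete_graph 1))"
proof -
  obtain f where f: "bij_betw f X {..<t}"
    using ex_bij_betw_finite_nat[OF assms(1)] assms(2) by (auto simp: atLeast0LessThan)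
  have "bij_betw (\<lambda>x. (f x, 0 :: nat)) X ({..<t} \<times> {..<1})"
    using f by (auto simp: bij_betw_def inj_on_def)
  then show ?thesis
    using assms(3) unfolding matches_def
    by (intro conjI exI[of _ "\<lambda>x. (f x, 0)"]) (auto simp: graph_copies_def complete_graph_def)
qed

lemma matches_star_graph:
  assumes "finite L" "card L = t" "c \<notin> L" "(c, c) \<notin> E"
    and "\<And>x. x \<in> L \<Longrightarrow> (c, x) \<in> E \<and> (x, c) \<in> E"
    and "\<And>x y. x \<in> L \<Longrightarrow> y \<in> L \<Longrightarrow> (x, y) \<notin> E"
  shows "matches (insert c L) E (star_graph t)"
proof -
  obtain f where f: "bij_betw f L {1..t}"
    using finite_same_card_bij[OF assms(1), of "{1..t}"] assms(2) by auto
  let ?g = "f(c := 0)"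
  have fL: "f x \<in> {1..t}" if "x \<in> L" for x using f that by (auto simp: bij_betw_def)
  have "inj_on ?g (insert c L)"
  proof -
    have "inj_on f L" using f by (simp add: bij_betw_def)
    then have "inj_on ?g L" using assms(3) by (auto simp: inj_on_def)
    moreover have "0 \<notin> f ` L" using fL by fastforce
    then have "?g c \<notin> ?g ` (L - {c})" using assms(3) by auto
    ultimately show ?thesis unfolding inj_on_insert by blast
  qed
  moreover have "f ` L = {1..t}" using f by (simp add: bij_betw_def)
  then have "?g ` insert c L = {0..t}"
    using assms(3) by (auto simp: fun_upd_image)
  ultimately have "bij_betw ?g (insert c L) {0..t}" by (simp add: bij_betw_def)
  moreover have "(x, y) \<in> E \<longleftrightarrow> (?g x, ?g y) \<in> parcs (star_graph t)"
    if xy: "x \<in> insert c L" "y \<in> insert c L" for x y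
  proof -
    consider "x = c" "y = c" | "x = c" "y \<in> L" | "x \<in> L" "y = c" | "x \<in> L" "y \<in> L"
      using xy by blast
    then show ?thesis
      using assms(3-6) fL[of x] fL[of y] by cases (auto simp: star_graph_def)
  qed
  moreover have "pverts (star_graph t) = {0..t}"
    "parcs (star_graph t) \<subseteq> pverts (star_graph t) \<times> pverts (star_graph t)"
    by (auto simp: star_graph_def)
  ultimately show ?thesis
    unfolding matches_def by metis
qed

section \<open>Maximal counterexamples and the removal of edges\<close>

lemma leaf_connected_mono:
  "leaf_connected k V E \<Longrightarrow> E \<subseteq> F \<Longrightarrow> leaf_connected k V F"
  using has_tree_mono unfolding leaf_connected_def by blast

lemma split_leaf_connected:
  assumes "finite X" "finite M" "finite P" "X \<inter> M = {}" "X \<inter> P = {}" "M \<inter> P = {}"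
    and "2 \<le> k" "k < card X" "card P + 2 \<le> card X" "k + 2 \<le> card (X \<union> M \<union> P)"
  shows "leaf_connected k (X \<union> M \<union> P) (split_arcs X M P)"
  unfolding leaf_connected_def
proof (intro allI impI)
  fix S assume S: "S \<subseteq> X \<union> M \<union> P \<and> card S = k"
  show "has_tree (split_arcs X M P) (X \<union> M \<union> P) S"
  proof (rule split_graph_has_tree)
    show "sym (split_arcs X M P)" by (auto simp: sym_def split_arcs_def)
    show "(x, y) \<notin> split_arcs X M P" if "x \<in> M" "y \<in> P" for x y
      using that assms(4-6) by (auto simp: split_arcs_def)
  qed (use S assms in \<open>auto simp: split_arcs_def\<close>)
qed

text \<open>
A complete graph is the case $M = P = \<emptyset>$ of \<open>split_leaf_connected\<close>.
\<close>
lemma not_leaf_connected_imp_noncomplete: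
  assumes "finite V" "2 \<le> k" "k + 2 \<le> card V" "\<not> leaf_connected k V E"
  shows "\<exists>x\<in>V. \<exists>y\<in>V. x \<noteq> y \<and> (x, y) \<notin> E"
proof (rule ccontr)
  assume "\<not> ?thesis"
  then have "split_arcs V {} {} \<subseteq> E" by (auto simp: split_arcs_def)
  moreover have "leaf_connected k (V \<union> {} \<union> {}) (split_arcs V {} {})"
    using assms(1-3) by (intro split_leaf_connected) auto
  ultimately show False
    using assms(4) leaf_connected_mono[of k V "split_arcs V {} {}" E] by simp
qed

text \<open>
Adding an edge to a maximal relation without the property creates the property, so the closure lemma
bounds the degree sums of its nonadjacent pairs.
\<close>
lemma maximal_not_leaf_connected:
  assumes "finite V" "E \<subseteq> V \<times> V" "sym E" "irrefl E" "\<not> leaf_connected k V E"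
  obtains F where "E \<subseteq> F" "F \<subseteq> V \<times> V" "sym F" "irrefl F" "\<not> leaf_connected k V F"
    "\<And>x y. x \<in> V \<Longrightarrow> y \<in> V \<Longrightarrow> x \<noteq> y \<Longrightarrow> (x, y) \<notin> F \<Longrightarrow>
      card (F `` {x}) + card (F `` {y}) + 2 \<le> card V + k"
proof -
  define C where "C = {F. E \<subseteq> F \<and> F \<subseteq> V \<times> V \<and> sym F \<and> irrefl F \<and> \<not> leaf_connected k V F}"
  have "finite C"
    by (rule finite_subset[of _ "Pow (V \<times> V)"]) (use assms(1) in \<open>auto simp: C_def\<close>)
  moreover have "E \<in> C" using assms by (simp add: C_def)
  ultimately have "\<exists>F\<in>C. E \<subseteq> F \<and> (\<forall>F'\<in>C. F \<subseteq> F' \<longrightarrow> F = F')"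
    by (rule finite_has_maximal2)
  then obtain F where F: "F \<in> C" and max: "\<And>F'. F' \<in> C \<Longrightarrow> F \<subseteq> F' \<Longrightarrow> F = F'"
    by auto
  have "card (F `` {x}) + card (F `` {y}) + 2 \<le> card V + k"
    if xy: "x \<in> V" "y \<in> V" "x \<noteq> y" "(x, y) \<notin> F" for x y
  proof (rule ccontr)
    assume "\<not> ?thesis"
    then have deg: "card V + k \<le> card (F `` {x}) + card (F `` {y}) + 1" by simp
    let ?F = "insert (x, y) (insert (y, x) F)"
    have F': "F \<subseteq> V \<times> V" "sym F" "irrefl F" using F by (auto simp: C_def)
    have "?F \<notin> C" using max[of ?F] xy by auto
    moreover have "E \<subseteq> ?F" "?F \<subseteq> V \<times> V" using F xy by (auto simp: C_def)
    moreover have "sym ?F" "irrefl ?F" using F' xy by (auto simp: sym_def irrefl_def)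
    ultimately have "leaf_connected k V ?F" by (simp add: C_def)
    then have "leaf_connected k V F"
      using has_tree_remove_edge[OF assms(1) F' xy deg] by (auto simp: leaf_connected_def)
    then show False using F by (simp add: C_def)
  qed
  with F that show ?thesis by (auto simp: C_def)
qed

definition zagreb :: "'a set \<Rightarrow> ('a \<times> 'a) set \<Rightarrow> nat" where
  "zagreb V E = (\<Sum>x\<in>V. (card (E `` {x}))\<^sup>2)"

lemma zagreb_mono:
  assumes "finite V" "F \<subseteq> V \<times> V" "E \<subseteq> F"
  shows "zagreb V E \<le> zagreb V F"
  unfolding zagreb_def
proof (rule sum_mono)
  fix x
  have "finite (F `` {x})" using assms(1,2) by (auto intro: finite_subset[of _ V])
  then have "card (E `` {x}) \<le> card (F `` {x})" using assms(3) by (intro card_mono) auto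
  then show "(card (E `` {x}))\<^sup>2 \<le> (card (F `` {x}))\<^sup>2" by (rule power_mono) simp
qed

text \<open>
Two degrees drop by one, from $d$ and $e$ say, which costs $(2d - 1) + (2e - 1)$; the equation is
arranged without subtraction.
\<close>
lemma zagreb_remove_edge:
  assumes V: "finite V" "F \<subseteq> V \<times> V" "sym F" "irrefl F" and xy: "(x, y) \<in> F"
  shows "zagreb V (F - {(x, y), (y, x)}) + 2 * card (F `` {x}) + 2 * card (F `` {y}) = zagreb V F + 2"
proof -
  let ?F = "F - {(x, y), (y, x)}"
  have ne: "x \<noteq> y" and yx: "(y, x) \<in> F" and inV: "x \<in> V" "y \<in> V"
    using assms by (auto simp: irrefl_def sym_def)
  have fin: "finite (F `` {z})" for z using V by (auto intro: finite_subset[of _ V])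
  have "?F `` {x} = F `` {x} - {y}" "?F `` {y} = F `` {y} - {x}" using ne by auto
  then have d: "card (F `` {x}) = Suc (card (?F `` {x}))" "card (F `` {y}) = Suc (card (?F `` {y}))"
    using card_Suc_Diff1[OF fin, of y x] card_Suc_Diff1[OF fin, of x y] xy yx by auto
  have rest: "(\<Sum>z\<in>V - {x} - {y}. (card (?F `` {z}))\<^sup>2) = (\<Sum>z\<in>V - {x} - {y}. (card (F `` {z}))\<^sup>2)"
  proof (rule sum.cong[OF refl])
    fix z assume "z \<in> V - {x} - {y}"
    then have "?F `` {z} = F `` {z}" by auto
    then show "(card (?F `` {z}))\<^sup>2 = (card (F `` {z}))\<^sup>2" by simp
  qed
  have split: "(\<Sum>z\<in>V. f z) = f x + (f y + (\<Sum>z\<in>V - {x} - {y}. f z))" for f :: "'a \<Rightarrow> nat"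
    using sum.remove[OF V(1) inV(1), of f] sum.remove[of "V - {x}" y f] V(1) inV(2) ne by simp
  show ?thesis
    unfolding zagreb_def split rest using d
    by (simp add: power2_eq_square algebra_simps)
qed

lemma split_degree:
  assumes "finite X" "finite M" "finite P" "X \<inter> M = {}" "X \<inter> P = {}" "M \<inter> P = {}"
  shows "x \<in> X \<Longrightarrow> card (split_arcs X M P `` {x}) + 1 = card X + card M + card P"
    and "x \<in> M \<Longrightarrow> card (split_arcs X M P `` {x}) + 1 = card X + card M"
    and "x \<in> P \<Longrightarrow> card (split_arcs X M P `` {x}) = card X"
proof -
  have "card (X \<union> M) = card X + card M"
    using assms by (simp add: card_Un_disjoint)
  moreover have "card (X \<union> M \<union> P) = card (X \<union> M) + card P"
    using assms by (intro card_Un_disjoint) auto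
  ultimately have cards: "card (X \<union> M) = card X + card M"
    "card (X \<union> M \<union> P) = card X + card M + card P" by simp_all
  show "card (split_arcs X M P `` {x}) + 1 = card X + card M + card P" if "x \<in> X"
  proof -
    have "split_arcs X M P `` {x} = (X \<union> M \<union> P) - {x}"
      using that by (auto simp: split_arcs_def)
    then show ?thesis
      using card_Suc_Diff1[of "X \<union> M \<union> P" x] that assms cards by simp
  qed
  show "card (split_arcs X M P `` {x}) + 1 = card X + card M" if "x \<in> M"
  proof -
    have "split_arcs X M P `` {x} = (X \<union> M) - {x}"
      using that assms(4-6) by (auto simp: split_arcs_def)
    then show ?thesis
      using card_Suc_Diff1[of "X \<union> M" x] that assms cards by simp
  qed
  show "card (split_arcs X M P `` {x}) = card X" if "x \<in> P"
  proof -
    have "split_arcs X M P `` {x} = X"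
      using that assms(4-6) by (auto simp: split_arcs_def)
    then show ?thesis by simp
  qed
qed

lemma zagreb_split_arcs:
  assumes "finite X" "finite M" "finite P" "X \<inter> M = {}" "X \<inter> P = {}" "M \<inter> P = {}"
  shows "int (zagreb (X \<union> M \<union> P) (split_arcs X M P))
    = zagreb_split (int (card X)) (int (card M)) (int (card P))"
proof -
  let ?d = "\<lambda>x. int (card (split_arcs X M P `` {x}))"
  note deg = split_degree[OF assms]
  have "(\<Sum>x\<in>X \<union> M \<union> P. (?d x)\<^sup>2) = (\<Sum>x\<in>X \<union> M. (?d x)\<^sup>2) + (\<Sum>x\<in>P. (?d x)\<^sup>2)"
    using assms by (intro sum.union_disjoint) auto
  also have "(\<Sum>x\<in>X \<union> M. (?d x)\<^sup>2) = (\<Sum>x\<in>X. (?d x)\<^sup>2) + (\<Sum>x\<in>M. (?d x)\<^sup>2)"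
    using assms by (intro sum.union_disjoint) auto
  also have "(\<Sum>x\<in>X. (?d x)\<^sup>2) = (\<Sum>x\<in>X. (int (card X) + int (card M) + int (card P) - 1)\<^sup>2)"
    using deg(1) by (intro sum.cong refl arg_cong[of _ _ "\<lambda>z. z\<^sup>2"]) (auto simp: algebra_simps simp flip: of_nat_add of_nat_Suc)
  also have "(\<Sum>x\<in>M. (?d x)\<^sup>2) = (\<Sum>x\<in>M. (int (card X) + int (card M) - 1)\<^sup>2)"
    using deg(2) by (intro sum.cong refl arg_cong[of _ _ "\<lambda>z. z\<^sup>2"]) (auto simp: algebra_simps simp flip: of_nat_add of_nat_Suc)
  also have "(\<Sum>x\<in>P. (?d x)\<^sup>2) = (\<Sum>x\<in>P. (int (card X))\<^sup>2)"
    using deg(3) by (intro sum.cong) auto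
  finally show ?thesis by (simp add: zagreb_def zagreb_split_def)
qed

theorem theorem3p1:
  fixes G :: "'a pair_pre_digraph" and n k :: nat
  assumes "2 \<le> k" and "k + 4 \<le> n"
    and "pair_graph G" and "Digraph_Component.connected (with_proj G)"
    and "card (pverts G) = n"
    and "k + 1 \<le> min_degree G"
    and "int (first_zagreb G) \<ge>
           int n ^ 3 - 8 * int n ^ 2 + (4 * int k + 25) * int n + 2 * int k ^ 2 - 4 * int k - 24"
  shows "k_leaf_connected k G \<or>
    graph_iso G (graph_join (complete_graph 3)
      (graph_union (complete_graph (n - 5)) (graph_copies 2 (complete_graph 1)))) \<or>
    graph_iso G (graph_join (complete_graph 4) (graph_copies 4 (complete_graph 1))) \<or>
    graph_iso G (graph_join (complete_graph 3) (graph_union (star_graph 3) (complete_graph 1))) \<or>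
    graph_iso G (graph_join (complete_graph 4)
      (graph_union (complete_graph 2) (graph_copies 3 (complete_graph 1)))) \<or>
    graph_iso G (graph_join (complete_graph 5) (graph_copies 5 (complete_graph 1)))"
proof (cases "leaf_connected k (pverts G) (parcs G)")
  case True
  then show ?thesis
    using leaf_connected_imp_k_leaf_connected[OF assms(3)] assms(2,5) by auto
next
  case False
  define V where "V = pverts G"
  define E where "E = parcs G"
  have V: "finite V" "card V = n" and E: "E \<subseteq> V \<times> V" "sym E" "irrefl E"
    using assms(3,5) by (auto simp: V_def E_def pair_graph_iff)
  have M1E: "zagreb_bound (int n) (int k) \<le> int (zagreb V E)"
    using assms(7) by (simp add: zagreb_bound_def first_zagreb_def zagreb_def vertex_degree_eq V_def E_def)
  have mindeg: "k + 1 \<le> card (E `` {x})" if "x \<in> V" for x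
  proof -
    have "min_degree G \<le> vertex_degree G x"
      using V(1) that unfolding min_degree_def V_def by (intro Min_le) auto
    then show ?thesis using assms(6) by (simp add: vertex_degree_eq E_def)
  qed
  have "\<not> leaf_connected k V E" using False by (simp add: V_def E_def)
  then obtain F where F: "E \<subseteq> F" "F \<subseteq> V \<times> V" "sym F" "irrefl F" "\<not> leaf_connected k V F"
    and nonadj: "\<And>x y. x \<in> V \<Longrightarrow> y \<in> V \<Longrightarrow> x \<noteq> y \<Longrightarrow> (x, y) \<notin> F \<Longrightarrow>
      card (F `` {x}) + card (F `` {y}) + 2 \<le> n + k"
    using maximal_not_leaf_connected[OF V(1) E] V(2) by metis
  have mindegF: "k + 1 \<le> card (F `` {x})" if "x \<in> V" for x
  proof -
    have "finite (F `` {x})" using V(1) F(2) by (auto intro: finite_subset[of _ V])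
    then have "card (E `` {x}) \<le> card (F `` {x})" using F(1) by (intro card_mono) auto
    with mindeg[OF that] show ?thesis by simp
  qed
  have M1F: "zagreb_bound (int n) (int k) \<le> int (\<Sum>x\<in>V. (card (F `` {x}))\<^sup>2)"
    using zagreb_mono[OF V(1) F(2,1)] M1E by (simp add: zagreb_def del: of_nat_sum)
  have noncomplete: "\<exists>x\<in>V. \<exists>y\<in>V. x \<noteq> y \<and> (x, y) \<notin> F"
    using not_leaf_connected_imp_noncomplete[OF V(1) assms(1) _ F(5)] V(2) assms(2) by simp
  obtain X M P where XMP: "V = X \<union> M \<union> P" "X \<inter> M = {}" "X \<inter> P = {}" "M \<inter> P = {}"
    and F_eq: "F = split_arcs X M P"
    and cards: "(card X = k + 1 \<and> card P = 2) \<or> (card X = k + 2 \<and> card P = 3 \<and> card M \<in> {1, 2}) \<or>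
     (card X = k + 3 \<and> card P = 4 \<and> card M = 1)"
    by (rule split_structure[OF V F(2-4) assms(1) nonadj mindegF noncomplete M1F])
      (assumption | rule that)+
  have fin: "finite X" "finite M" "finite P" using V(1) XMP(1) by auto
  have n: "n = card X + card M + card P"
  proof -
    have "card (X \<union> M \<union> P) = card (X \<union> M) + card P"
      using fin XMP by (intro card_Un_disjoint) auto
    then show ?thesis using V(2) XMP fin by (simp add: card_Un_disjoint)
  qed
  have k2: "k = 2"
  proof (rule ccontr)
    assume "k \<noteq> 2"
    then have "leaf_connected k (X \<union> M \<union> P) (split_arcs X M P)"
      using cards assms(1,2) V(2) XMP fin by (intro split_leaf_connected) auto
    then show False using F(5) XMP(1) F_eq by simp
  qed
  have zF: "int (zagreb V F) = zagreb_split (int (card X)) (int (card M)) (int (card P))"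
    using zagreb_split_arcs[OF fin XMP(2-4)] by (simp add: XMP(1) F_eq)
  note deg = split_degree[OF fin XMP(2-4), folded F_eq]
  have lost: "zagreb V E + 2 * card (F `` {x}) + 2 * card (F `` {y}) \<le> zagreb V F + 2"
    if "(x, y) \<in> F" "(x, y) \<notin> E" for x y
  proof -
    have "E \<subseteq> F - {(x, y), (y, x)}" using that F(1) E(2) by (auto dest: symD)
    then have "zagreb V E \<le> zagreb V (F - {(x, y), (y, x)})"
      using V(1) F(2) by (intro zagreb_mono) auto
    then show ?thesis
      using zagreb_remove_edge[OF V(1) F(2-4) that(1)] by linarith
  qed
  have EF_or: "E = F \<or> (\<exists>x y. x \<in> X \<and> (x, y) \<in> F \<and> (x, y) \<notin> E) \<or>
      (\<exists>x y. x \<in> M \<and> y \<in> M \<and> (x, y) \<in> F \<and> (x, y) \<notin> E)"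
  proof (cases "E = F")
    case False
    then obtain x y where "(x, y) \<in> F" "(x, y) \<notin> E" using F(1) by auto
    moreover then have "(y, x) \<in> F" "(y, x) \<notin> E" using F(3) E(2) by (auto dest: symD)
    moreover have "x \<in> X \<or> y \<in> X \<or> x \<in> M \<and> y \<in> M"
      using \<open>(x, y) \<in> F\<close> by (auto simp: F_eq split_arcs_def)
    ultimately show ?thesis by blast
  qed simp
  note iso = matches_imp_graph_iso[OF assms(3), folded V_def E_def]
  have XK: "matches X E (complete_graph (card X))" if "E = F"
    using that fin XMP by (intro matches_complete_graph) (auto simp: F_eq split_arcs_def)
  have MK: "matches M E (complete_graph (card M))" if "E = F"
    using that fin XMP by (intro matches_complete_graph) (auto simp: F_eq split_arcs_def)
  have PK: "matches P E (graph_copies (card P) (complete_graph 1))" if "E = F"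
    using that fin XMP by (intro matches_graph_copies_K1) (auto simp: F_eq split_arcs_def)
  have split_iso: "matches V E (graph_join (complete_graph (card X))
      (graph_union (complete_graph (card M)) (graph_copies (card P) (complete_graph 1))))" if "E = F"
  proof -
    have "matches (X \<union> (M \<union> P)) E (graph_join (complete_graph (card X))
      (graph_union (complete_graph (card M)) (graph_copies (card P) (complete_graph 1))))"
      using XMP that
      by (intro matches_graph_join matches_graph_union XK MK PK) (auto simp: F_eq split_arcs_def)
    then show ?thesis by (simp add: XMP(1) Un_assoc)
  qed
  have indep_iso: "matches V E (graph_join (complete_graph (card X))
      (graph_copies (card M + card P) (complete_graph 1)))" if EF: "E = F" and M1: "card M = 1"
  proof -
    obtain m where m: "M = {m}" using M1 by (rule card_1_singletonE)
    have "matches (M \<union> P) E (graph_copies (card M + card P) (complete_graph 1))"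
      using fin XMP EF M1 m
      by (intro matches_graph_copies_K1) (auto simp: F_eq split_arcs_def card_Un_disjoint)
    then have "matches (X \<union> (M \<union> P)) E (graph_join (complete_graph (card X))
      (graph_copies (card M + card P) (complete_graph 1)))"
      using XMP EF by (intro matches_graph_join XK[OF EF]) (auto simp: F_eq split_arcs_def)
    then show ?thesis by (simp add: XMP(1) Un_assoc)
  qed
  consider "card X = 3" "card P = 2" "card M + 5 = n" | "card X = 4" "card P = 3" "card M = 2" "n = 9"
    | "card X = 4" "card P = 3" "card M = 1" "n = 8" | "card X = 5" "card P = 4" "card M = 1" "n = 10"
    using cards n k2 by auto
  then show ?thesis
  proof cases
    case 1
    have z: "zagreb_split 3 (int n - 5) 2 = zagreb_bound (int n) 2"
      unfolding zagreb_split_def zagreb_bound_def by (simp add: algebra_simps power2_eq_square power3_eq_cube)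
    have m: "int (card M) = int n - 5" using 1 by linarith
    have le: "zagreb V F \<le> zagreb V E"
      using M1E zF z unfolding 1(1,2) k2 m by simp
    have "E = F"
    proof (rule ccontr)
      assume "E \<noteq> F"
      then obtain x y where xy: "(x, y) \<in> F" "(x, y) \<notin> E" using F(1) by auto
      then have "x \<in> V" using F(2) by auto
      then show False using lost[OF xy] mindegF[OF \<open>x \<in> V\<close>] le assms(1) by linarith
    qed
    moreover have "card M = n - 5" using 1 by linarith
    ultimately show ?thesis using iso[OF split_iso] 1 by simp
  next
    case 2
    have le: "zagreb V F \<le> zagreb V E"
      using M1E zF 2 k2 by (simp add: zagreb_split_def zagreb_bound_def)
    have "E = F"
    proof (rule ccontr)
      assume "E \<noteq> F"
      then obtain x y where xy: "(x, y) \<in> F" "(x, y) \<notin> E" using F(1) by auto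
      then have "x \<in> V" using F(2) by auto
      then show False using lost[OF xy] mindegF[OF \<open>x \<in> V\<close>] le assms(1) by linarith
    qed
    from iso[OF split_iso[OF this]] 2 show ?thesis by simp
  next
    case 3
    obtain m where m: "M = {m}" using 3(3) by (rule card_1_singletonE)
    have le: "zagreb V F \<le> zagreb V E + 20"
      using M1E zF 3 k2 by (simp add: zagreb_split_def zagreb_bound_def)
    have noM: "(x, y) \<notin> F" if "x \<in> M" "y \<in> M" for x y
      using that m by (auto simp: F_eq split_arcs_def)
    show ?thesis
    proof (cases "E = F")
      case True
      from iso[OF indep_iso[OF this 3(3)]] 3 show ?thesis by simp
    next
      case False
      then obtain x y where xy: "x \<in> X" "(x, y) \<in> F" "(x, y) \<notin> E" using EF_or noM by blast
      have dx: "card (F `` {x}) = 7" using deg(1)[OF xy(1)] 3 by simp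
      \<comment> \<open>An edge inside \<open>X\<close> would cost 26, an edge to \<open>M \<union> P\<close> costs exactly 20.\<close>
      have "y \<notin> X"
      proof
        assume "y \<in> X"
        then have "card (F `` {y}) = 7" using deg(1)[of y] 3 by simp
        then show False using lost[OF xy(2,3)] dx le by linarith
      qed
      then have y: "y \<in> M \<union> P" using F(2) xy(2) XMP(1) by auto
      then have dy: "card (F `` {y}) = 4" using deg(2,3)[of y] 3 by auto
      let ?F = "F - {(x, y), (y, x)}"
      have "E \<subseteq> ?F" using xy F(1) E(2) by (auto dest: symD)
      have symF': "sym ?F" "irrefl ?F" "?F \<subseteq> V \<times> V" using F(2-4) by (auto simp: sym_def irrefl_def)
      have z': "zagreb V ?F + 20 = zagreb V F"
        using zagreb_remove_edge[OF V(1) F(2-4) xy(2)] dx dy by simp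
      \<comment> \<open>The surplus 20 is used up by the edge \<open>xy\<close>, so it is the only missing one.\<close>
      have E_eq: "E = ?F"
      proof (rule ccontr)
        assume "E \<noteq> ?F"
        then obtain x' y' where xy': "(x', y') \<in> ?F" "(x', y') \<notin> E" using \<open>E \<subseteq> ?F\<close> by auto
        have "x' \<in> V" using xy'(1) F(2) by auto
        have "E \<subseteq> ?F - {(x', y'), (y', x')}"
          using xy' \<open>E \<subseteq> ?F\<close> E(2) by (auto dest: symD)
        then have "zagreb V E \<le> zagreb V (?F - {(x', y'), (y', x')})"
          using V(1) symF'(3) by (intro zagreb_mono) auto
        moreover have "card (E `` {x'}) \<le> card (?F `` {x'})"
          using \<open>E \<subseteq> ?F\<close> symF'(3) V(1) by (intro card_mono) (auto intro: finite_subset[of _ V])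
        ultimately show False
          using zagreb_remove_edge[OF V(1) symF'(3,1,2) xy'(1)] le z' mindeg[OF \<open>x' \<in> V\<close>] assms(1) by linarith
      qed
      \<comment> \<open>Without \<open>xy\<close> the vertex \<open>x\<close> is no longer dominating: it is the centre of the star.\<close>
      let ?L = "(M \<union> P) - {y}"
      have finR: "finite (M \<union> P)" "card (M \<union> P) = 4"
        using fin XMP(4) 3 by (simp_all add: card_Un_disjoint)
      have xR: "x \<notin> M \<union> P" using xy(1) XMP by auto
      have "matches (insert x ?L \<union> {y}) E (graph_union (star_graph 3) (complete_graph 1))"
      proof (intro matches_graph_union matches_star_graph matches_complete_graph)
        show "card ?L = 3" using finR y by simp
      qed (use finR xR xy(1) y m XMP(2-4) in \<open>auto simp: E_eq F_eq split_arcs_def\<close>)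
      moreover have "matches (X - {x}) E (complete_graph 3)"
        using fin 3 xy(1) \<open>y \<notin> X\<close> by (intro matches_complete_graph) (auto simp: E_eq F_eq split_arcs_def)
      ultimately have "matches ((X - {x}) \<union> (insert x ?L \<union> {y})) E
          (graph_join (complete_graph 3) (graph_union (star_graph 3) (complete_graph 1)))"
        using y xy(1) XMP(2-4) \<open>y \<notin> X\<close>
        by (intro matches_graph_join) (auto simp: E_eq F_eq split_arcs_def)
      moreover have "(X - {x}) \<union> (insert x ?L \<union> {y}) = V"
        using xy(1) y XMP(1) by auto
      ultimately have "matches V E (graph_join (complete_graph 3)
          (graph_union (star_graph 3) (complete_graph 1)))" by (simp only:)
      from iso[OF this] show ?thesis by blast
    qed
  next
    case 4
    obtain m where m: "M = {m}" using 4(3) by (rule card_1_singletonE)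
    have le: "zagreb V F \<le> zagreb V E + 24"
      using M1E zF 4 k2 by (simp add: zagreb_split_def zagreb_bound_def)
    have noM: "(x, y) \<notin> F" if "x \<in> M" "y \<in> M" for x y
      using that m by (auto simp: F_eq split_arcs_def)
    have "E = F"
    proof (rule ccontr)
      assume "E \<noteq> F"
      then obtain x y where xy: "x \<in> X" "(x, y) \<in> F" "(x, y) \<notin> E" using EF_or noM by blast
      have dx: "card (F `` {x}) = 9" using deg(1)[OF xy(1)] 4 by simp
      have "y \<in> X \<union> M \<union> P" using F(2) xy(2) XMP(1) by auto
      then have dy: "5 \<le> card (F `` {y})" using deg[of y] 4 by auto
      show False using lost[OF xy(2,3)] dx dy le by linarith
    qed
    from iso[OF indep_iso[OF this 4(3)]] 4 show ?thesis by simp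
  qed
qed

end
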